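(* Let $g\ge3$, $d\ge3$, and let $S_{g,d}$ be the cycle $C_g$ with $d-2$ pendant leaves at each cycle vertex. Consider the weightings of $S_{g,d}$ in which every leaf edge has weight $1$ and every cycle edge has the same weight $a>0$. For such a weighting every leaf edge has curvature $\kappa_{\mathrm{leaf}}(a)$ and every cycle edge has curvature $\kappa_{\mathrm{cyc}}(a)$, where $$\kappa_{\mathrm{leaf}}(a)=\frac{4-2a}{d},\qquad \kappa_{\mathrm{cyc}}(a)=-\frac{2(d-2)}{a\,d}+\frac{\max(6-g,0)}{d}.$$ Consequently $\Delta(a):=\kappa_{\mathrm{cyc}}(a)-\kappa_{\mathrm{leaf}}(a)$ is strictly increasing on $(0,\infty)$ with $\Delta(0^+)=-\infty$ and $\Delta(+\infty)=+\infty$, so it has a unique zero $a^\ast$. Hence $S_{g,d}$ carries a symmetric discrete Einstein metric (all cycle edges of one weight, all leaf edges of one weight), unique up to scaling among symmetric weightings. For $g\ge6$ it is balanced and is the Perron eigenvector of the Ricci matrix $R_{S_{g,d}}$; for $g\le5$ it is not balanced.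
   Context: Weighted graphs: $G=(V,E)$ is a finite connected simple graph, $w:E\to\mathbb{R}_{>0}$ an edge weighting, $d_v$ the combinatorial degree, and $d(x,y)$ the least total weight of a path from $x$ to $y$. Lin--Lu--Yau curvature: for $\alpha\in[0,1]$ let $\mu_x^\alpha$ be the probability measure with mass $\alpha$ at $x$ and $(1-\alpha)/d_x$ at each neighbour of $x$. Let $W$ be the $L^1$-Wasserstein distance with respect to $d$. For an edge $x\sim y$ put $\kappa_\alpha(x,y)=1-W(\mu_x^\alpha,\mu_y^\alpha)/d(x,y)$ and $\kappa_{xy}=\lim_{\alpha\to1}\kappa_\alpha(x,y)/(1-\alpha)$. A positive weighting $w$ is a discrete Einstein metric of curvature $\kappa$ if $\kappa_e=\kappa$ for every edge $e$. Balanced: with cycle edges $c_1,\dots,c_g$ in cyclic order (indices mod $g$) and $L=\sum_jw(c_j)$, $w$ is balanced if $w(c_{j-1})+w(c_j)+w(c_{j+1})\le L/2$ for every $j$. Ricci matrix: $R_G\in\mathbb{R}^{E\times E}$ has diagonal entries $-(1/d_x+1/d_y)$ for $e=\{x,y\}$, entry $1/d_z$ for $e\ne e'$ with $e\cap e'=\{z\}$, and $0$ for disjoint edges; its Perron eigenvector is the positive eigenvector (unique up to scaling) of its largest eigenvalue. *)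

theory Defs
  imports "HOL-Probability.Probability_Mass_Function"
begin

text \<open>
  A finite simple graph is given by its set of edges, each a two-element set of vertices; all
  graphs here are without isolated vertices, so the vertex set is the union of the edges.
  Edge weightings are functions on sets of vertices whose values matter only on the edges.
\<close>

definition neighbours :: "'v set set \<Rightarrow> 'v \<Rightarrow> 'v set" where
  "neighbours E x = {y. {x, y} \<in> E}"

definition degree :: "'v set set \<Rightarrow> 'v \<Rightarrow> nat" where
  "degree E x = card (neighbours E x)"

definition paths :: "'v set set \<Rightarrow> 'v \<Rightarrow> 'v \<Rightarrow> 'v list set" where
  "paths E x y = {p. p \<noteq> [] \<and> hd p = x \<and> last p = y \<and> distinct p \<and>
     successively (\<lambda>u v. {u, v} \<in> E) p}"

definition path_weight :: "('v set \<Rightarrow> real) \<Rightarrow> 'v list \<Rightarrow> real" where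
  "path_weight w p = sum_list (map2 (\<lambda>u v. w {u, v}) p (tl p))"

text \<open>In a finite connected graph the infimum is over a finite nonempty set, hence a minimum.\<close>

definition graph_dist :: "'v set set \<Rightarrow> ('v set \<Rightarrow> real) \<Rightarrow> 'v \<Rightarrow> 'v \<Rightarrow> real" where
  "graph_dist E w x y = (INF p \<in> paths E x y. path_weight w p)"

definition walk_measure :: "'v set set \<Rightarrow> real \<Rightarrow> 'v \<Rightarrow> 'v pmf" where
  "walk_measure E \<alpha> x = embed_pmf (\<lambda>z.
     if z = x then \<alpha>
     else if z \<in> neighbours E x then (1 - \<alpha>) / real (degree E x)
     else 0)"

text \<open>The mass function above is a genuine one, so \<^const>\<open>embed_pmf\<close> realises it:\<close>

lemma pmf_walk_measure:
  assumes "finite (neighbours E x)" "neighbours E x \<noteq> {}" "x \<notin> neighbours E x"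
    and "0 \<le> \<alpha>" "\<alpha> \<le> 1"
  shows "pmf (walk_measure E \<alpha> x) z =
     (if z = x then \<alpha>
      else if z \<in> neighbours E x then (1 - \<alpha>) / real (degree E x)
      else 0)"
proof -
  define f where "f = (\<lambda>z. if z = x then \<alpha>
      else if z \<in> neighbours E x then (1 - \<alpha>) / real (degree E x) else 0)"
  have nn: "0 \<le> f z" for z using assms by (simp add: f_def)
  have deg: "degree E x > 0" using assms by (simp add: degree_def card_gt_0_iff)
  have "(\<integral>\<^sup>+z. ennreal (f z) \<partial>count_space UNIV)
      = (\<Sum>z\<in>insert x (neighbours E x). ennreal (f z))"
    by (rule nn_integral_count_space') (use assms in \<open>auto simp: f_def\<close>)
  also have "\<dots> = ennreal (\<Sum>z\<in>insert x (neighbours E x). f z)"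
    by (rule sum_ennreal) (simp add: nn)
  also have "(\<Sum>z\<in>insert x (neighbours E x). f z) = f x + (\<Sum>z\<in>neighbours E x. f z)"
    using assms by simp
  also have "(\<Sum>z\<in>neighbours E x. f z)
      = (\<Sum>z\<in>neighbours E x. (1 - \<alpha>) / real (degree E x))"
    by (rule sum.cong) (use assms in \<open>auto simp: f_def\<close>)
  also have "f x + \<dots> = 1" using deg by (simp add: f_def degree_def)
  finally have "pmf (embed_pmf f) z = f z" by (intro pmf_embed_pmf nn) simp_all
  then show ?thesis by (simp add: f_def walk_measure_def)
qed

definition couplings :: "'v pmf \<Rightarrow> 'v pmf \<Rightarrow> ('v \<times> 'v) pmf set" where
  "couplings \<mu> \<nu> = {\<pi>. map_pmf fst \<pi> = \<mu> \<and> map_pmf snd \<pi> = \<nu>}"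

definition wasserstein :: "('v \<Rightarrow> 'v \<Rightarrow> real) \<Rightarrow> 'v pmf \<Rightarrow> 'v pmf \<Rightarrow> real" where
  "wasserstein D \<mu> \<nu> = (INF \<pi> \<in> couplings \<mu> \<nu>. measure_pmf.expectation \<pi> (\<lambda>(x, y). D x y))"

definition alpha_curvature ::
    "'v set set \<Rightarrow> ('v set \<Rightarrow> real) \<Rightarrow> real \<Rightarrow> 'v \<Rightarrow> 'v \<Rightarrow> real" where
  "alpha_curvature E w \<alpha> x y =
     1 - wasserstein (graph_dist E w) (walk_measure E \<alpha> x) (walk_measure E \<alpha> y)
           / graph_dist E w x y"

text \<open>
  The curvature is a relation, so that a statement about its value includes the existence of the
  limit. As \<open>\<alpha>\<close> ranges over \<open>[0, 1]\<close>, the limit at 1 is a left limit.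
\<close>

definition has_LLY_curvature ::
    "'v set set \<Rightarrow> ('v set \<Rightarrow> real) \<Rightarrow> 'v \<Rightarrow> 'v \<Rightarrow> real \<Rightarrow> bool" where
  "has_LLY_curvature E w x y \<kappa> \<longleftrightarrow>
     ((\<lambda>\<alpha>. alpha_curvature E w \<alpha> x y / (1 - \<alpha>)) \<longlongrightarrow> \<kappa>) (at_left 1)"

definition einstein_metric :: "'v set set \<Rightarrow> ('v set \<Rightarrow> real) \<Rightarrow> real \<Rightarrow> bool" where
  "einstein_metric E w \<kappa> \<longleftrightarrow>
     (\<forall>e\<in>E. 0 < w e) \<and> (\<forall>x y. {x, y} \<in> E \<longrightarrow> has_LLY_curvature E w x y \<kappa>)"

text \<open>The edges of the cycle in cyclic order are \<open>c 0, \<dots>, c (g - 1)\<close>.\<close>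

definition balanced :: "nat \<Rightarrow> (nat \<Rightarrow> 'v set) \<Rightarrow> ('v set \<Rightarrow> real) \<Rightarrow> bool" where
  "balanced g c w \<longleftrightarrow>
     (\<forall>j<g. w (c ((j + g - 1) mod g)) + w (c j) + w (c ((j + 1) mod g))
              \<le> (\<Sum>i<g. w (c i)) / 2)"

text \<open>Distinct edges of a simple graph share at most one vertex, so the sum over \<open>e \<inter> f\<close> has at
  most one term.\<close>

definition ricci_matrix :: "'v set set \<Rightarrow> 'v set \<Rightarrow> 'v set \<Rightarrow> real" where
  "ricci_matrix E e f =
     (if e = f then - (\<Sum>v\<in>e. 1 / real (degree E v))
      else (\<Sum>z\<in>e \<inter> f. 1 / real (degree E z)))"

text \<open>
  Real matrices with rows and columns indexed by a finite set \<open>I\<close>. Real eigenvalues suffice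
  for symmetric matrices.
\<close>

definition eigenvector_on ::
    "'i set \<Rightarrow> ('i \<Rightarrow> 'i \<Rightarrow> real) \<Rightarrow> ('i \<Rightarrow> real) \<Rightarrow> real \<Rightarrow> bool" where
  "eigenvector_on I A v \<theta> \<longleftrightarrow>
     (\<exists>i\<in>I. v i \<noteq> 0) \<and> (\<forall>i\<in>I. (\<Sum>j\<in>I. A i j * v j) = \<theta> * v i)"

definition largest_eigenvalue_on :: "'i set \<Rightarrow> ('i \<Rightarrow> 'i \<Rightarrow> real) \<Rightarrow> real \<Rightarrow> bool" where
  "largest_eigenvalue_on I A \<theta> \<longleftrightarrow>
     (\<exists>v. eigenvector_on I A v \<theta>) \<and> (\<forall>\<mu> v. eigenvector_on I A v \<mu> \<longrightarrow> \<mu> \<le> \<theta>)"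

text \<open>The uniqueness up to scaling is part of the notion.\<close>

definition perron_eigenvector_on ::
    "'i set \<Rightarrow> ('i \<Rightarrow> 'i \<Rightarrow> real) \<Rightarrow> ('i \<Rightarrow> real) \<Rightarrow> bool" where
  "perron_eigenvector_on I A v \<longleftrightarrow>
     (\<exists>\<theta>. largest_eigenvalue_on I A \<theta> \<and> eigenvector_on I A v \<theta> \<and> (\<forall>i\<in>I. 0 < v i) \<and>
        (\<forall>u. eigenvector_on I A u \<theta> \<and> (\<forall>i\<in>I. 0 < u i)
               \<longrightarrow> (\<exists>c>0. \<forall>i\<in>I. u i = c * v i)))"

text \<open>
  The graph \<open>S_graph g d\<close>: \<open>Cyc i\<close> for \<open>i < g\<close> are the cycle vertices, and
  \<open>Leaf i k\<close> for \<open>k < d - 2\<close> are the leaves attached to \<open>Cyc i\<close>.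
\<close>

datatype vertex = Cyc nat | Leaf nat nat

definition cycle_edge :: "nat \<Rightarrow> nat \<Rightarrow> vertex set" where
  "cycle_edge g j = {Cyc j, Cyc (Suc j mod g)}"

definition cycle_edges :: "nat \<Rightarrow> vertex set set" where
  "cycle_edges g = {cycle_edge g j |j. j < g}"

definition leaf_edges :: "nat \<Rightarrow> nat \<Rightarrow> vertex set set" where
  "leaf_edges g d = {{Cyc i, Leaf i k} |i k. i < g \<and> k < d - 2}"

definition S_graph :: "nat \<Rightarrow> nat \<Rightarrow> vertex set set" where
  "S_graph g d = cycle_edges g \<union> leaf_edges g d"

definition leaf_cycle_weighting ::
    "nat \<Rightarrow> nat \<Rightarrow> real \<Rightarrow> real \<Rightarrow> (vertex set \<Rightarrow> real) \<Rightarrow> bool" where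
  "leaf_cycle_weighting g d b a w \<longleftrightarrow>
     (\<forall>e\<in>leaf_edges g d. w e = b) \<and> (\<forall>e\<in>cycle_edges g. w e = a)"

definition symmetric_einstein_metric :: "nat \<Rightarrow> nat \<Rightarrow> (vertex set \<Rightarrow> real) \<Rightarrow> bool" where
  "symmetric_einstein_metric g d w \<longleftrightarrow>
     (\<exists>b>0. \<exists>a>0. leaf_cycle_weighting g d b a w) \<and> (\<exists>\<kappa>. einstein_metric (S_graph g d) w \<kappa>)"

definition kappa_leaf :: "nat \<Rightarrow> real \<Rightarrow> real" where
  "kappa_leaf d a = (4 - 2 * a) / real d"

definition kappa_cyc :: "nat \<Rightarrow> nat \<Rightarrow> real \<Rightarrow> real" where
  "kappa_cyc g d a = - (2 * (real d - 2)) / (a * real d) + max (6 - real g) 0 / real d"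

definition Delta :: "nat \<Rightarrow> nat \<Rightarrow> real \<Rightarrow> real" where
  "Delta g d a = kappa_cyc g d a - kappa_leaf d a"

end

theory Submission
  imports Defs
begin

text \<open>
  For each edge the Wasserstein distance is pinned down by an explicit transport plan together with a
  1-Lipschitz potential along which every transported mass moves at full slope. For a leaf edge all mass
  passes through the cycle vertex; for a cycle edge leaves move to leaves and the two outer cycle
  neighbours are matched with each other, at \<open>min 3 (g - 3)\<close> cycle edges apart, which is where the
  dependence on \<open>g\<close> comes from. With leaf weight \<open>b\<close> and cycle weight \<open>a\<close> the curvatures depend only on
  \<open>a / b\<close>, so the symmetric Einstein metrics are given by the unique zero of \<open>Delta\<close>. For \<open>g \<ge> 6\<close> the two
  Einstein equations coincide with the two eigenvalue equations of the Ricci matrix on symmetric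
  vectors (with eigenvalue \<open>- \<kappa>\<close>), and a positive eigenvector is the Perron eigenvector by irreducibility.
\<close>

section \<open>Graph distance and Wasserstein distance\<close>

lemma path_weight_simps [simp]:
  "path_weight w [u] = 0"
  "path_weight w (u # v # p) = w {u, v} + path_weight w (v # p)"
  by (simp_all add: path_weight_def)

lemma path_weight_nonneg:
  assumes "\<And>e. e \<in> E \<Longrightarrow> 0 \<le> w e" "successively (\<lambda>u v. {u, v} \<in> E) p"
  shows "0 \<le> path_weight w p"
  using assms(2) by (induction p rule: induct_list012) (auto simp: path_weight_def assms(1))

lemma path_weight_suffix_le:
  assumes "\<And>e. e \<in> E \<Longrightarrow> 0 \<le> w e" "successively (\<lambda>u v. {u, v} \<in> E) (p @ q)" "q \<noteq> []"
  shows "path_weight w q \<le> path_weight w (p @ q)"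
  using assms(2)
proof (induction p)
  case (Cons u p)
  obtain v r where vr: "p @ q = v # r" using \<open>q \<noteq> []\<close> by (cases "p @ q") auto
  have "{u, v} \<in> E" "path_weight w q \<le> path_weight w (p @ q)"
    using Cons vr by auto
  then show ?case using vr assms(1)[of "{u, v}"] by simp
qed simp

text \<open>Loop erasure: a new first vertex is put before the path found for the rest of the walk.
  If it already occurs there, only the part from that occurrence on is kept, which costs no more
  because weights are nonnegative.\<close>

lemma walk_contains_path:
  assumes nn: "\<And>e. e \<in> E \<Longrightarrow> 0 \<le> w e"
    and "p \<noteq> []" "successively (\<lambda>u v. {u, v} \<in> E) p"
  shows "\<exists>q \<in> paths E (hd p) (last p). path_weight w q \<le> path_weight w p"
  using assms(2,3)
proof (induction p rule: induct_list012)
  case (2 x)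
  show ?case by (rule bexI[of _ "[x]"]) (auto simp: paths_def)
next
  case (3 u v p)
  then obtain q where q: "q \<in> paths E v (last (v # p))" "path_weight w q \<le> path_weight w (v # p)"
    by auto
  have uv: "{u, v} \<in> E" using 3 by simp
  show ?case
  proof (cases "u \<in> set q")
    case True
    then obtain xs ys where xy: "q = xs @ u # ys" by (meson split_list)
    have "path_weight w (u # ys) \<le> path_weight w q"
      using q(1) unfolding xy by (intro path_weight_suffix_le[OF nn]) (auto simp: paths_def)
    moreover have "u # ys \<in> paths E u (last (v # p))"
      using q(1) unfolding xy by (auto simp: paths_def successively_append_iff)
    ultimately show ?thesis using q(2) nn[OF uv] by (intro bexI[of _ "u # ys"]) auto
  next
    case False
    obtain q' where q': "q = v # q'" using q(1) by (cases q) (auto simp: paths_def)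
    have "u # q \<in> paths E u (last (v # p))"
      using q(1) False uv unfolding q' by (auto simp: paths_def)
    then show ?thesis using q(2) unfolding q' by (intro bexI[of _ "u # v # q'"]) auto
  qed
qed simp

text \<open>\<open>paths\<close> admits only lists without repetition. Bounding the distance by
  arbitrary walks spares every later upper bound a distinctness check.\<close>

lemma graph_dist_le_walk:
  assumes nn: "\<And>e. e \<in> E \<Longrightarrow> 0 \<le> w e"
    and "p \<noteq> []" "successively (\<lambda>u v. {u, v} \<in> E) p"
  shows "graph_dist E w (hd p) (last p) \<le> path_weight w p"
proof -
  obtain q where q: "q \<in> paths E (hd p) (last p)" "path_weight w q \<le> path_weight w p"
    using walk_contains_path[of E w p] assms by blast
  show ?thesis unfolding graph_dist_def
  proof (rule cINF_lower2[where x = q])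
    show "bdd_below (path_weight w ` paths E (hd p) (last p))"
      using path_weight_nonneg[OF nn] by (intro bdd_belowI[of _ 0]) (auto simp: paths_def)
  qed (use q in auto)
qed

text \<open>The differences of \<open>f\<close> telescope along a path. Nonemptiness matters because
  the infimum of an empty set of reals carries no information.\<close>

lemma potential_diff_le_graph_dist:
  fixes f :: "'v \<Rightarrow> real"
  assumes lip: "\<And>u v. {u, v} \<in> E \<Longrightarrow> f v - f u \<le> w {u, v}" and "paths E u v \<noteq> {}"
  shows "f v - f u \<le> graph_dist E w u v"
  unfolding graph_dist_def
proof (rule cINF_greatest[OF assms(2)])
  fix p assume "p \<in> paths E u v"
  moreover have "p \<noteq> [] \<Longrightarrow> successively (\<lambda>u v. {u, v} \<in> E) p \<Longrightarrow> f (last p) - f (hd p) \<le> path_weight w p"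
    by (induction p rule: induct_list012) (auto dest!: lip)
  ultimately show "f v - f u \<le> path_weight w p" by (auto simp: paths_def)
qed

section \<open>Symmetry of distance, transport cost and curvature\<close>

lemma path_weight_snoc:
  "p \<noteq> [] \<Longrightarrow> path_weight w (p @ [v]) = path_weight w p + w {last p, v}"
  by (induction p rule: induct_list012) auto

lemma path_weight_rev: "path_weight w (rev p) = path_weight w p"
proof (induction p rule: induct_list012)
  case (3 x y zs)
  have "path_weight w (rev (x # y # zs)) = path_weight w (rev (y # zs)) + w {last (rev (y # zs)), x}"
    using path_weight_snoc[of "rev (y # zs)" w x] by simp
  moreover have "last (rev (y # zs)) = y" by (simp only: last_rev list.sel)
  ultimately show ?case using 3 by (simp add: insert_commute)
qed (auto simp: path_weight_def)

lemma graph_dist_commute: "graph_dist E w x y = graph_dist E w y x"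
proof -
  have "p \<in> paths E y x" if "rev p \<in> paths E x y" for p x y
    using that by (auto simp: paths_def hd_rev last_rev insert_commute)
  then have "paths E y x = rev ` paths E x y"
    by (fastforce intro: image_eqI[of _ _ "rev _"])
  then show ?thesis by (simp add: graph_dist_def image_image path_weight_rev)
qed

lemma couplings_swap: "\<pi> \<in> couplings \<mu> \<nu> \<Longrightarrow> map_pmf prod.swap \<pi> \<in> couplings \<nu> \<mu>"
  by (auto simp: couplings_def map_pmf_comp)

lemma wasserstein_commute:
  assumes "\<And>x y. D x y = D y x"
  shows "wasserstein D \<mu> \<nu> = wasserstein D \<nu> \<mu>"
proof -
  have sw: "couplings \<nu> \<mu> = map_pmf prod.swap ` couplings \<mu> \<nu>"
  proof (intro subset_antisym subsetI)
    fix \<pi> assume "\<pi> \<in> couplings \<nu> \<mu>"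
    then show "\<pi> \<in> map_pmf prod.swap ` couplings \<mu> \<nu>"
      by (intro image_eqI[of _ _ "map_pmf prod.swap \<pi>"] couplings_swap) (simp_all add: map_pmf_comp)
  qed (auto intro: couplings_swap)
  have "(\<lambda>p. (\<lambda>(x, y). D x y) (prod.swap p)) = (\<lambda>(x, y). D x y)" using assms by auto
  then show ?thesis unfolding wasserstein_def sw image_image by simp
qed

text \<open>Certificates are built for one orientation of an edge, while curvature statements range
  over both.\<close>

lemma has_LLY_curvature_commute:
  "has_LLY_curvature E w x y \<kappa> \<longleftrightarrow> has_LLY_curvature E w y x \<kappa>"
  unfolding has_LLY_curvature_def alpha_curvature_def graph_dist_commute[of E w x y]
    wasserstein_commute[of "graph_dist E w", OF graph_dist_commute, of "walk_measure E _ x"] ..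

text \<open>Complementary slackness: a plan supported where the Lipschitz potential is tight is optimal,
  and the potential then gives its cost.\<close>

lemma wasserstein_eq_tight_plan:
  fixes f :: "'v \<Rightarrow> real" and m :: "'i \<Rightarrow> real"
  assumes I: "finite I" and m: "\<And>i. i \<in> I \<Longrightarrow> 0 \<le> m i"
    and \<mu>: "\<And>z. pmf \<mu> z = (\<Sum>i\<in>I. if s i = z then m i else 0)"
    and \<nu>: "\<And>z. pmf \<nu> z = (\<Sum>i\<in>I. if t i = z then m i else 0)"
    and lip: "\<And>u v. u \<in> set_pmf \<mu> \<Longrightarrow> v \<in> set_pmf \<nu> \<Longrightarrow> f v - f u \<le> D u v"
    and tight: "\<And>i. i \<in> I \<Longrightarrow> D (s i) (t i) \<le> f (t i) - f (s i)"
  shows "wasserstein D \<mu> \<nu> = (\<Sum>i\<in>I. m i * (f (t i) - f (s i)))"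
proof -
  have supp: "set_pmf \<mu> \<subseteq> s ` I" "set_pmf \<nu> \<subseteq> t ` I"
    by (force simp: set_pmf_iff \<mu> \<nu> intro: ccontr sum.neutral)+
  then have fin: "finite (set_pmf \<mu>)" "finite (set_pmf \<nu>)"
    using I finite_surj by blast+
  define h where "h i = (if i \<in> I then m i else 0)" for i
  have h0: "0 \<le> h i" for i using m by (simp add: h_def)
  have "(\<Sum>i\<in>I. m i) = (\<Sum>z\<in>s ` I. pmf \<mu> z)"
    unfolding \<mu> using I by (subst sum.swap) simp
  also have "\<dots> = 1" using supp I by (intro sum_pmf_eq_1) auto
  finally have tot: "(\<Sum>i\<in>I. m i) = 1" .
  \<comment> \<open>The plan will be the image of a measure on indices, so different indices may
    share a source, a target or both.\<close>
  define \<rho> where "\<rho> = embed_pmf h"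
  have "(\<integral>\<^sup>+i. ennreal (h i) \<partial>count_space UNIV) = (\<Sum>i\<in>I. ennreal (h i))"
    by (rule nn_integral_count_space') (use I in \<open>auto simp: h_def\<close>)
  also have "\<dots> = ennreal (\<Sum>i\<in>I. h i)" by (rule sum_ennreal) (simp add: h0)
  also have "(\<Sum>i\<in>I. h i) = 1" using tot by (simp add: h_def)
  finally have \<rho>: "pmf \<rho> i = h i" for i
    unfolding \<rho>_def by (intro pmf_embed_pmf h0) simp_all
  have \<rho>I: "set_pmf \<rho> \<subseteq> I" by (auto simp: set_pmf_iff \<rho> h_def split: if_splits)
  have marg: "pmf (map_pmf r \<rho>) z = (\<Sum>i\<in>I. if r i = z then m i else 0)" for r :: "'i \<Rightarrow> 'v" and z
  proof -
    have "pmf (map_pmf r \<rho>) z = measure \<rho> (r -` {z} \<inter> I)"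
      unfolding pmf_map using \<rho>I by (intro measure_prob_cong_0) (auto simp: set_pmf_iff)
    also have "\<dots> = (\<Sum>i\<in>r -` {z} \<inter> I. h i)"
      using I by (subst measure_measure_pmf_finite) (auto simp: \<rho>)
    also have "\<dots> = (\<Sum>i\<in>I. if r i = z then m i else 0)"
      using I by (simp add: sum.If_cases h_def Int_commute vimage_def Collect_conj_eq)
    finally show ?thesis .
  qed
  have maps: "map_pmf s \<rho> = \<mu>" "map_pmf t \<rho> = \<nu>"
    by (auto intro!: pmf_eqI simp: marg \<mu> \<nu>)
  define \<pi>0 where "\<pi>0 = map_pmf (\<lambda>i. (s i, t i)) \<rho>"
  have \<pi>0: "\<pi>0 \<in> couplings \<mu> \<nu>" by (simp add: couplings_def \<pi>0_def map_pmf_comp maps)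
  have E: "measure_pmf.expectation (map_pmf r \<rho>) f = (\<Sum>i\<in>I. m i * f (r i))" for r :: "'i \<Rightarrow> 'v"
  proof -
    have "measure_pmf.expectation \<rho> (\<lambda>i. f (r i)) = (\<Sum>i\<in>I. f (r i) * pmf \<rho> i)"
      using I \<rho>I by (intro integral_measure_pmf_real) auto
    then show ?thesis by (simp add: \<rho> h_def mult.commute)
  qed
  \<comment> \<open>The expected increase of \<open>f\<close> depends only on the marginals, hence
    is the same for all couplings. Comparing it with \<open>D\<close> pointwise on the support
    bounds every cost from below, and the cost of \<open>\<pi>0\<close> from above.\<close>
  have dual: "measure_pmf.expectation \<pi> (\<lambda>(u, v). f v - f u) = (\<Sum>i\<in>I. m i * (f (t i) - f (s i)))"
    and int: "integrable \<pi> (\<lambda>(u, v). g u v)" and sub: "set_pmf \<pi> \<subseteq> set_pmf \<mu> \<times> set_pmf \<nu>"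
    if "\<pi> \<in> couplings \<mu> \<nu>" for \<pi> and g :: "'v \<Rightarrow> 'v \<Rightarrow> real"
  proof -
    have mp: "map_pmf fst \<pi> = \<mu>" "map_pmf snd \<pi> = \<nu>" using that by (auto simp: couplings_def)
    show sub: "set_pmf \<pi> \<subseteq> set_pmf \<mu> \<times> set_pmf \<nu>"
      using mp by (force simp flip: mp)
    then have fp: "finite (set_pmf \<pi>)" using fin by (meson finite_SigmaI finite_subset)
    then show "integrable \<pi> (\<lambda>(u, v). g u v)" by (rule integrable_measure_pmf_finite)
    have "measure_pmf.expectation \<pi> (\<lambda>(u, v). f v - f u)
        = measure_pmf.expectation \<pi> (\<lambda>p. f (snd p)) - measure_pmf.expectation \<pi> (\<lambda>p. f (fst p))"
      unfolding case_prod_beta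
      by (intro Bochner_Integration.integral_diff integrable_measure_pmf_finite fp)
    also have "\<dots> = measure_pmf.expectation \<nu> f - measure_pmf.expectation \<mu> f"
      by (simp flip: mp)
    also have "\<dots> = (\<Sum>i\<in>I. m i * (f (t i) - f (s i)))"
      by (simp only: E right_diff_distrib sum_subtractf flip: maps)
    finally show "measure_pmf.expectation \<pi> (\<lambda>(u, v). f v - f u)
        = (\<Sum>i\<in>I. m i * (f (t i) - f (s i)))" .
  qed
  have lower: "(\<Sum>i\<in>I. m i * (f (t i) - f (s i))) \<le> measure_pmf.expectation \<pi> (\<lambda>(u, v). D u v)"
    if \<pi>: "\<pi> \<in> couplings \<mu> \<nu>" for \<pi>
    unfolding dual[OF \<pi>, symmetric]
    by (intro integral_mono_AE int[OF \<pi>]) (use sub[OF \<pi>] lip in \<open>auto simp: AE_measure_pmf_iff\<close>)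
  have upper: "measure_pmf.expectation \<pi>0 (\<lambda>(u, v). D u v) \<le> (\<Sum>i\<in>I. m i * (f (t i) - f (s i)))"
    unfolding dual[OF \<pi>0, symmetric]
    by (intro integral_mono_AE int[OF \<pi>0]) (use \<rho>I tight in \<open>auto simp: AE_measure_pmf_iff \<pi>0_def\<close>)
  show ?thesis unfolding wasserstein_def
  proof (rule antisym)
    show "(INF \<pi>\<in>couplings \<mu> \<nu>. measure_pmf.expectation \<pi> (\<lambda>(u, v). D u v))
        \<le> (\<Sum>i\<in>I. m i * (f (t i) - f (s i)))"
      by (rule cINF_lower2[where x = \<pi>0]) (use \<pi>0 upper in \<open>auto intro!: bdd_belowI2 lower\<close>)
    show "(\<Sum>i\<in>I. m i * (f (t i) - f (s i)))
        \<le> (INF \<pi>\<in>couplings \<mu> \<nu>. measure_pmf.expectation \<pi> (\<lambda>(u, v). D u v))"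
      using \<pi>0 by (intro cINF_greatest lower) auto
  qed
qed

section \<open>Transport between walk measures in equal units of mass\<close>

text \<open>\<open>spreads E n B s x\<close> says that giving mass \<open>(1 - \<alpha>) / n\<close> to every \<open>s i\<close> with \<open>i \<in> B\<close>, and the
  remaining mass to \<open>x\<close>, produces \<open>walk_measure E \<alpha> x\<close>.\<close>

definition spreads :: "'v set set \<Rightarrow> nat \<Rightarrow> 'i set \<Rightarrow> ('i \<Rightarrow> 'v) \<Rightarrow> 'v \<Rightarrow> bool" where
  "spreads E n B s x \<longleftrightarrow> finite B \<and> 0 < n \<and> 0 < degree E x \<and> x \<notin> neighbours E x \<and>
     s ` B \<subseteq> insert x (neighbours E x) \<and> card {i \<in> B. s i = x} = 1 \<and>
     (\<forall>z\<in>neighbours E x. degree E x * card {i \<in> B. s i = z} = n)"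

text \<open>The case of one unit for each vertex of the closed neighbourhood. A general
  \<open>n\<close> serves an endpoint of smaller degree, namely a leaf, whose only neighbour takes
  several units.\<close>

lemma spreads_bij_betw:
  assumes "bij_betw s B (insert x (neighbours E x))" "0 < degree E x" "x \<notin> neighbours E x"
  shows "spreads E (degree E x) B s x"
proof -
  have fin: "finite (neighbours E x)" using assms(2) by (auto simp: degree_def card_gt_0_iff)
  have one: "card {i \<in> B. s i = z} = 1" if "z \<in> insert x (neighbours E x)" for z
  proof -
    have "z \<in> s ` B" using that bij_betw_imp_surj_on[OF assms(1)] by simp
    then obtain i where "i \<in> B" "z = s i" by blast
    then have "{i \<in> B. s i = z} = {i}" using assms(1) by (auto simp: bij_betw_def dest: inj_onD)
    then show ?thesis by simp
  qed
  show ?thesis unfolding spreads_def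
    using assms fin one bij_betw_finite[OF assms(1)] by (auto simp: bij_betw_def)
qed

text \<open>Exactly one unit sits at \<open>x\<close> and completes the reserved mass to
  \<open>\<alpha>\<close>. A neighbour holds \<open>n / degree E x\<close> units of size
  \<open>(1 - \<alpha>) / n\<close>, which is its share
  \<open>(1 - \<alpha>) / degree E x\<close>.\<close>

lemma pmf_walk_measure_spreads:
  assumes s: "spreads E n B s x" and \<alpha>: "0 \<le> \<alpha>" "\<alpha> \<le> 1"
  shows "pmf (walk_measure E \<alpha> x) z
    = (if z = x then \<alpha> - (1 - \<alpha>) / n else 0) + (1 - \<alpha>) / n * card {i \<in> B. s i = z}"
proof -
  have "finite (neighbours E x)" "neighbours E x \<noteq> {}"
    using s by (auto simp: spreads_def degree_def card_gt_0_iff)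
  then have p: "pmf (walk_measure E \<alpha> x) z = (if z = x then \<alpha>
      else if z \<in> neighbours E x then (1 - \<alpha>) / degree E x else 0)"
    using s by (intro pmf_walk_measure \<alpha>) (auto simp: spreads_def)
  consider "z = x" | "z \<noteq> x" "z \<in> neighbours E x" | "z \<noteq> x" "z \<notin> neighbours E x" by blast
  then show ?thesis
  proof cases
    case 2
    then have n: "degree E x * card {i \<in> B. s i = z} = n" "0 < n" using s by (auto simp: spreads_def)
    then have "real n = real (degree E x) * real (card {i \<in> B. s i = z})" by (metis of_nat_mult)
    moreover from n have "card {i \<in> B. s i = z} \<noteq> 0" by (metis mult_0_right less_irrefl)
    ultimately show ?thesis using 2 p by simp
  next
    case 3
    then have "{i \<in> B. s i = z} = {}" using s by (auto simp: spreads_def)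
    then have "card {i \<in> B. s i = z} = 0" by (simp only: card.empty)
    then show ?thesis using 3 p by simp
  qed (use p s in \<open>auto simp: spreads_def\<close>)
qed

text \<open>The reserved mass moves from \<open>x\<close> to \<open>y\<close>, and unit
  \<open>i\<close> from \<open>s i\<close> to \<open>t i\<close>. For \<open>\<alpha>\<close> close
  to 1 the cost is affine in \<open>\<alpha>\<close>, and the quotient in the definition of
  curvature is already constant, so its limit is that constant.\<close>

lemma has_LLY_curvature_certificate:
  fixes f :: "'v \<Rightarrow> real" and s t :: "'i \<Rightarrow> 'v"
  assumes w: "\<And>e. e \<in> E \<Longrightarrow> 0 < w e"
    and conn: "\<And>u v. u \<in> insert x (neighbours E x) \<Longrightarrow> v \<in> insert y (neighbours E y) \<Longrightarrow>
      paths E u v \<noteq> {}"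
    and lip: "\<And>u v. {u, v} \<in> E \<Longrightarrow> f v - f u \<le> w {u, v}"
    and xy: "{x, y} \<in> E" "w {x, y} = f y - f x"
    and s: "spreads E n B s x" and t: "spreads E n B t y"
    and tight: "\<And>i. i \<in> B \<Longrightarrow> graph_dist E w (s i) (t i) \<le> f (t i) - f (s i)"
    and \<kappa>: "\<kappa> = (real n + 1 - (\<Sum>i\<in>B. f (t i) - f (s i)) / w {x, y}) / real n"
  shows "has_LLY_curvature E w x y \<kappa>"
proof -
  define S where "S = (\<Sum>i\<in>B. f (t i) - f (s i))"
  have n: "0 < n" and B: "finite B" using s by (auto simp: spreads_def)
  have w0: "0 < w {x, y}" by (rule w[OF xy(1)])
  \<comment> \<open>An edge could be longer than some detour; the full slope of \<open>f\<close>
    along it excludes this.\<close>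
  have le: "graph_dist E w x y \<le> f y - f x"
    using graph_dist_le_walk[of E w "[x, y]"] w[THEN less_imp_le] xy(1) by (simp flip: xy(2))
  have "f y - f x \<le> graph_dist E w x y"
    by (intro potential_diff_le_graph_dist lip conn) auto
  with le xy have dxy: "graph_dist E w x y = w {x, y}" by simp
  have supp: "set_pmf (walk_measure E \<alpha> z) \<subseteq> insert z (neighbours E z)"
    if "spreads E n B r z" "0 \<le> \<alpha>" "\<alpha> \<le> 1" for \<alpha> z and r :: "'i \<Rightarrow> 'v"
    using that by (subst subset_iff, subst set_pmf_iff, subst pmf_walk_measure)
      (auto simp: spreads_def degree_def card_gt_0_iff)
  \<comment> \<open>The lower bound on \<open>\<alpha>\<close> says precisely that the reserved mass
    \<open>\<alpha> - (1 - \<alpha>) / n\<close> is positive.\<close>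
  have val: "alpha_curvature E w \<alpha> x y / (1 - \<alpha>) = \<kappa>" if \<alpha>: "1 / (real n + 1) < \<alpha>" "\<alpha> < 1" for \<alpha>
  proof -
    have \<alpha>0: "0 \<le> \<alpha>" "\<alpha> \<le> 1" using \<alpha> by (auto intro: less_imp_le order_trans[of 0 "1 / (real n + 1)"])
    define \<epsilon> where "\<epsilon> = (1 - \<alpha>) / n"
    have \<epsilon>: "0 \<le> \<epsilon>" "0 \<le> \<alpha> - \<epsilon>" using \<alpha> n by (auto simp: \<epsilon>_def field_simps)
    \<comment> \<open>\<open>None\<close> indexes the reserved mass and \<open>Some i\<close> the
      unit \<open>i\<close>.\<close>
    define m where "m i = (case i of None \<Rightarrow> \<alpha> - \<epsilon> | Some (_ :: 'i) \<Rightarrow> \<epsilon>)" for i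
    have split: "(\<Sum>i\<in>insert None (Some ` B). h i) = h None + (\<Sum>i\<in>B. h (Some i))" for h :: "'i option \<Rightarrow> real"
      using B by (simp add: sum.reindex)
    have marg: "pmf (walk_measure E \<alpha> z) v
        = (\<Sum>i\<in>insert None (Some ` B). if case_option z r i = v then m i else 0)"
      if "spreads E n B r z" for r z v
      unfolding split pmf_walk_measure_spreads[OF that \<alpha>0] using B
      by (auto simp: m_def \<epsilon>_def simp flip: sum.inter_filter)
    have "wasserstein (graph_dist E w) (walk_measure E \<alpha> x) (walk_measure E \<alpha> y)
        = (\<Sum>i\<in>insert None (Some ` B). m i * (f (case_option y t i) - f (case_option x s i)))"
    proof (rule wasserstein_eq_tight_plan)
      fix u v assume "u \<in> set_pmf (walk_measure E \<alpha> x)" "v \<in> set_pmf (walk_measure E \<alpha> y)"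
      then show "f v - f u \<le> graph_dist E w u v"
        using supp[OF s \<alpha>0] supp[OF t \<alpha>0] by (intro potential_diff_le_graph_dist lip conn) auto
    qed (use B \<epsilon> le tight in \<open>auto simp: m_def marg[OF s] marg[OF t]\<close>)
    also have "\<dots> = (\<alpha> - \<epsilon>) * w {x, y} + \<epsilon> * S"
      unfolding split by (simp add: m_def xy S_def sum_distrib_left)
    finally have W: "wasserstein (graph_dist E w) (walk_measure E \<alpha> x) (walk_measure E \<alpha> y)
        = (\<alpha> - \<epsilon>) * w {x, y} + \<epsilon> * S" .
    show ?thesis
      unfolding alpha_curvature_def dxy \<kappa> S_def[symmetric] W \<epsilon>_def
      using \<alpha>(2) w0 n by (simp add: field_simps)
  qed
  have "eventually (\<lambda>\<alpha>. \<alpha> \<in> {1 / (real n + 1)<..<1}) (at_left (1 :: real))"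
    using n by (intro eventually_at_leftI[of "1 / (real n + 1)"]) auto
  then have "eventually (\<lambda>\<alpha>. alpha_curvature E w \<alpha> x y / (1 - \<alpha>) = \<kappa>) (at_left 1)"
    by eventually_elim (use val in simp)
  then show ?thesis unfolding has_LLY_curvature_def by (rule tendsto_eventually)
qed

section \<open>The cycle with pendant leaves\<close>

lemma paths_nonempty_if_reachable:
  assumes "(\<lambda>u v. {u, v} \<in> E)\<^sup>*\<^sup>* u v"
  shows "paths E u v \<noteq> {}"
proof -
  have "\<exists>p. p \<noteq> [] \<and> hd p = u \<and> last p = v \<and> successively (\<lambda>u v. {u, v} \<in> E) p"
    using assms
  proof induction
    case base
    show ?case by (rule exI[of _ "[u]"]) simp
  next
    case (step v z)
    then obtain p where "p \<noteq> []" "hd p = u" "last p = v" "successively (\<lambda>u v. {u, v} \<in> E) p" by blast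
    then show ?case using step.hyps by (intro exI[of _ "p @ [z]"]) (simp add: successively_append_iff)
  qed
  \<comment> \<open>With zero weights, loop erasure just turns a walk into a path.\<close>
  then show ?thesis using walk_contains_path[of E "\<lambda>_. 0"] by fastforce
qed

section \<open>Cyclic indices and the structure of the graph\<close>

definition nxt :: "nat \<Rightarrow> nat \<Rightarrow> nat" where "nxt g i = Suc i mod g"

definition prv :: "nat \<Rightarrow> nat \<Rightarrow> nat" where "prv g i = (i + g - 1) mod g"

lemma nxt_if: "i < g \<Longrightarrow> nxt g i = (if Suc i = g then 0 else Suc i)"
  by (simp add: nxt_def)

lemma prv_if: "i < g \<Longrightarrow> prv g i = (if i = 0 then g - 1 else i - 1)"
  by (cases i) (simp_all add: prv_def)

context
  fixes g d :: nat
  assumes g: "3 \<le> g" and d: "3 \<le> d"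
begin

lemma nxt_prv_less [simp]: "nxt g i < g" "prv g i < g"
  using g by (simp_all add: nxt_def prv_def)

text \<open>This is where \<open>g \<ge> 3\<close> enters: the two cycle neighbours of a vertex are
  distinct, which gives cycle vertices degree \<open>d\<close>.\<close>

lemma nxt_prv [simp]:
  assumes "i < g"
  shows "nxt g (prv g i) = i" "prv g (nxt g i) = i" "nxt g i \<noteq> i" "prv g i \<noteq> i" "prv g i \<noteq> nxt g i"
    "nxt g (nxt g i) \<noteq> i" "i \<noteq> nxt g i" "i \<noteq> prv g i" "nxt g i \<noteq> prv g i" "i \<noteq> nxt g (nxt g i)"
  using assms g by (auto simp: nxt_if prv_if)

lemma doubleton_S_graph_iff:
  "{u, v} \<in> S_graph g d \<longleftrightarrow> (\<exists>i<g. u = Cyc i \<and> v = Cyc (nxt g i) \<or> v = Cyc i \<and> u = Cyc (nxt g i) \<or>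
     (\<exists>k<d - 2. u = Cyc i \<and> v = Leaf i k \<or> v = Cyc i \<and> u = Leaf i k))"
  by (auto simp: S_graph_def cycle_edges_def cycle_edge_def leaf_edges_def nxt_def doubleton_eq_iff)

lemma neighbours_Leaf: "i < g \<Longrightarrow> k < d - 2 \<Longrightarrow> neighbours (S_graph g d) (Leaf i k) = {Cyc i}"
  by (auto simp: neighbours_def doubleton_S_graph_iff)

lemma neighbours_Cyc:
  assumes "i < g"
  shows "neighbours (S_graph g d) (Cyc i) = {Cyc (nxt g i), Cyc (prv g i)} \<union> Leaf i ` {..<d - 2}"
  using assms by (auto simp: neighbours_def doubleton_S_graph_iff intro: exI[of _ "prv g i"])

lemma sum_neighbours_Cyc:
  fixes h :: "vertex \<Rightarrow> real"
  assumes "i < g"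
  shows "(\<Sum>z\<in>neighbours (S_graph g d) (Cyc i). h z)
    = h (Cyc (nxt g i)) + h (Cyc (prv g i)) + (\<Sum>k<d - 2. h (Leaf i k))"
proof -
  have "(\<Sum>z\<in>Leaf i ` {..<d - 2}. h z) = (\<Sum>k<d - 2. h (Leaf i k))"
    by (subst sum.reindex) (auto simp: inj_on_def)
  then show ?thesis unfolding neighbours_Cyc[OF assms] using assms
    by (subst sum.union_disjoint) auto
qed

lemma finite_neighbours_Cyc: "i < g \<Longrightarrow> finite (neighbours (S_graph g d) (Cyc i))"
  by (simp add: neighbours_Cyc)

lemma degree_Cyc: "i < g \<Longrightarrow> degree (S_graph g d) (Cyc i) = d"
  using sum_neighbours_Cyc[of i "\<lambda>_. 1"] d by (simp add: degree_def)

lemma degree_Leaf: "i < g \<Longrightarrow> k < d - 2 \<Longrightarrow> degree (S_graph g d) (Leaf i k) = 1"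
  by (simp add: degree_def neighbours_Leaf)

lemma Cyc_notin_neighbours: "i < g \<Longrightarrow> Cyc i \<notin> neighbours (S_graph g d) (Cyc i)"
  by (auto simp: neighbours_Cyc)

definition "S_vertices = Cyc ` {..<g} \<union> {Leaf i k | i k. i < g \<and> k < d - 2}"

lemma neighbours_subset_S_vertices: "neighbours (S_graph g d) u \<subseteq> S_vertices"
  by (auto simp: neighbours_def doubleton_S_graph_iff S_vertices_def)

lemma paths_S_graph_nonempty:
  assumes "u \<in> S_vertices" "v \<in> S_vertices"
  shows "paths (S_graph g d) u v \<noteq> {}"
proof (rule paths_nonempty_if_reachable)
  define R where "R = (\<lambda>u v. {u, v} \<in> S_graph g d)"
  have sym: "R\<^sup>*\<^sup>* y x" if "R\<^sup>*\<^sup>* x y" for x y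
  proof -
    have "symp R" by (auto simp: R_def symp_def insert_commute)
    then show ?thesis using that by (metis symp_rtranclp sympD)
  qed
  have C: "R\<^sup>*\<^sup>* (Cyc 0) (Cyc i)" if "i < g" for i
    using that
  proof (induction i)
    case (Suc i)
    then have "R (Cyc i) (Cyc (Suc i))"
      by (auto simp: R_def doubleton_S_graph_iff nxt_if intro!: exI[of _ i])
    with Suc show ?case by (meson Suc_lessD rtranclp.rtrancl_into_rtrancl)
  qed simp
  have "R\<^sup>*\<^sup>* (Cyc 0) x" if "x \<in> S_vertices" for x
  proof -
    from that consider i where "i < g" "x = Cyc i" | i k where "i < g" "k < d - 2" "x = Leaf i k"
      by (auto simp: S_vertices_def)
    then show ?thesis
    proof cases
      case 2
      then have "R (Cyc i) x" by (auto simp: R_def doubleton_S_graph_iff)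
      with C[OF 2(1)] show ?thesis by (meson rtranclp.rtrancl_into_rtrancl)
    qed (simp add: C)
  qed
  then show "(\<lambda>u v. {u, v} \<in> S_graph g d)\<^sup>*\<^sup>* u v"
    using assms sym unfolding R_def[symmetric] by (meson rtranclp_trans)
qed

lemma weight_eq:
  assumes "leaf_cycle_weighting g d b a w" "i < g"
  shows "w {Cyc i, Cyc (nxt g i)} = a" "w {Cyc i, Cyc (prv g i)} = a"
    "k < d - 2 \<Longrightarrow> w {Cyc i, Leaf i k} = b" "w {Cyc (nxt g i), Cyc i} = a" "w {Cyc (prv g i), Cyc i} = a"
    "k < d - 2 \<Longrightarrow> w {Leaf i k, Cyc i} = b"
proof -
  have "{Cyc i, Cyc (nxt g i)} \<in> cycle_edges g" "{Cyc (prv g i), Cyc (nxt g (prv g i))} \<in> cycle_edges g"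
    using assms(2) nxt_prv_less unfolding cycle_edges_def cycle_edge_def nxt_def[symmetric] by blast+
  then show "w {Cyc i, Cyc (nxt g i)} = a" "w {Cyc i, Cyc (prv g i)} = a"
    "w {Cyc (nxt g i), Cyc i} = a" "w {Cyc (prv g i), Cyc i} = a"
    using assms by (simp_all add: leaf_cycle_weighting_def insert_commute)
  assume "k < d - 2"
  then have "{Cyc i, Leaf i k} \<in> leaf_edges g d" using assms(2) by (auto simp: leaf_edges_def)
  then show "w {Cyc i, Leaf i k} = b" "w {Leaf i k, Cyc i} = b"
    using assms(1) by (simp_all add: leaf_cycle_weighting_def insert_commute)
qed

lemma weight_pos:
  assumes "leaf_cycle_weighting g d b a w" "0 < a" "0 < b" "e \<in> S_graph g d"
  shows "0 < w e"
  using assms by (auto simp: leaf_cycle_weighting_def S_graph_def)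

lemma lipschitz_on_edges:
  fixes f :: "vertex \<Rightarrow> real"
  assumes w: "leaf_cycle_weighting g d b a w"
    and cyc: "\<And>i. i < g \<Longrightarrow> \<bar>f (Cyc (nxt g i)) - f (Cyc i)\<bar> \<le> a"
    and leaf: "\<And>i k. i < g \<Longrightarrow> k < d - 2 \<Longrightarrow> \<bar>f (Leaf i k) - f (Cyc i)\<bar> \<le> b"
    and uv: "{u, v} \<in> S_graph g d"
  shows "f v - f u \<le> w {u, v}"
proof -
  from uv obtain i where i: "i < g"
    "u = Cyc i \<and> v = Cyc (nxt g i) \<or> v = Cyc i \<and> u = Cyc (nxt g i) \<or>
     (\<exists>k<d - 2. u = Cyc i \<and> v = Leaf i k \<or> v = Cyc i \<and> u = Leaf i k)"
    unfolding doubleton_S_graph_iff by blast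
  then show ?thesis
    using weight_eq[OF w i(1)] cyc[OF i(1)] leaf[OF i(1)] by (fastforce simp: abs_le_iff)
qed

section \<open>Curvature of leaf edges and cycle edges\<close>

lemma S_graph_edges:
  "i < g \<Longrightarrow> {Cyc i, Cyc (nxt g i)} \<in> S_graph g d"
  "i < g \<Longrightarrow> {Cyc (nxt g i), Cyc i} \<in> S_graph g d"
  "i < g \<Longrightarrow> {Cyc (prv g i), Cyc i} \<in> S_graph g d"
  "i < g \<Longrightarrow> k < d - 2 \<Longrightarrow> {Cyc i, Leaf i k} \<in> S_graph g d"
  "i < g \<Longrightarrow> k < d - 2 \<Longrightarrow> {Leaf i k, Cyc i} \<in> S_graph g d"
  by (auto simp: doubleton_S_graph_iff intro: exI[of _ "prv g i"])

text \<open>One unit stays at the leaf and \<open>d\<close> units start at \<open>Cyc i\<close>. Of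
  these one stays, two go to the cycle neighbours at cost \<open>a\<close> each, and
  \<open>d - 3\<close> go to the other leaves at cost \<open>b\<close> each, in total
  \<open>2 * a + (d - 3) * b\<close>.\<close>

lemma has_LLY_curvature_leaf:
  assumes w: "leaf_cycle_weighting g d b a w" and pos: "0 < a" "0 < b"
    and i: "i < g" and k: "k < d - 2"
  shows "has_LLY_curvature (S_graph g d) w (Leaf i k) (Cyc i) (kappa_leaf d (a / b))"
proof -
  let ?E = "S_graph g d"
  define B where "B = insert (Cyc i) (neighbours ?E (Cyc i))"
  define s where "s z = (if z = Leaf i k then Leaf i k else Cyc i)" for z
  \<comment> \<open>The distance from \<open>Leaf i k\<close> near \<open>Cyc i\<close>, kept
    constant at \<open>b + a\<close> on the rest of the graph.\<close>
  define f where "f z = (case z of Cyc j \<Rightarrow> if j = i then b else b + a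
      | Leaf j l \<Rightarrow> if j \<noteq> i then b + a else if l = k then 0 else 2 * b)" for z
  have B: "finite B" "card B = Suc d"
    using i by (simp_all add: B_def finite_neighbours_Cyc Cyc_notin_neighbours degree_Cyc flip: degree_def)
  have leafB: "Leaf i k \<in> B" using i k by (simp add: B_def neighbours_Cyc)
  have wE: "0 \<le> w e" if "e \<in> ?E" for e using weight_pos[OF w pos that] by simp
  show ?thesis
  proof (rule has_LLY_curvature_certificate[where f = f and B = B and s = s and t = "\<lambda>z. z" and n = d])
    show "0 < w e" if "e \<in> ?E" for e using weight_pos[OF w pos that] .
    show "f v - f u \<le> w {u, v}" if "{u, v} \<in> ?E" for u v
      by (rule lipschitz_on_edges[OF w _ _ that]) (use pos in \<open>auto simp: f_def\<close>)
    show "{Leaf i k, Cyc i} \<in> ?E" using i k by (rule S_graph_edges)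
    show "w {Leaf i k, Cyc i} = f (Cyc i) - f (Leaf i k)"
      using weight_eq(6)[OF w i k] by (simp add: f_def)
    show "paths ?E u v \<noteq> {}"
      if "u \<in> insert (Leaf i k) (neighbours ?E (Leaf i k))" "v \<in> insert (Cyc i) (neighbours ?E (Cyc i))" for u v
      using that neighbours_subset_S_vertices i k
      by (intro paths_S_graph_nonempty) (auto simp: S_vertices_def)
    \<comment> \<open>The leaf has degree 1, so its neighbour must receive all \<open>n = d\<close>
      units; \<open>B\<close> has \<open>d + 1\<close> elements.\<close>
    have "{z \<in> B. s z = Leaf i k} = {Leaf i k}" "{z \<in> B. s z = Cyc i} = B - {Leaf i k}"
      using leafB by (auto simp: s_def)
    then show "spreads ?E d B s (Leaf i k)"
      using i k d B leafB by (auto simp: spreads_def degree_Leaf neighbours_Leaf s_def)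
    show "spreads ?E d B (\<lambda>z. z) (Cyc i)"
      using spreads_bij_betw[of "\<lambda>z. z" B "Cyc i" ?E] i d
      by (simp add: degree_Cyc Cyc_notin_neighbours B_def bij_betw_def)
    show "graph_dist ?E w (s z) z \<le> f z - f (s z)" if "z \<in> B" for z
    proof -
      have "z = s z \<or> z = Cyc (nxt g i) \<or> z = Cyc (prv g i) \<or> (\<exists>l<d - 2. l \<noteq> k \<and> z = Leaf i l)"
        using that i by (auto simp: B_def neighbours_Cyc s_def)
      then consider "z = s z" | "z = Cyc (nxt g i)" | "z = Cyc (prv g i)"
        | l where "l < d - 2" "l \<noteq> k" "z = Leaf i l" by blast
      then show ?thesis
      proof cases
        case 1
        then show ?thesis using graph_dist_le_walk[of ?E w "[z]"] wE by simp
      next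
        case 2
        then show ?thesis using graph_dist_le_walk[of ?E w "[Cyc i, Cyc (nxt g i)]"] wE i
            S_graph_edges(1)[OF i] weight_eq[OF w i] by (simp add: f_def s_def)
      next
        case 3
        then show ?thesis using graph_dist_le_walk[of ?E w "[Cyc i, Cyc (prv g i)]"] wE i
            S_graph_edges(3)[OF i] weight_eq[OF w i] by (simp add: f_def s_def insert_commute)
      next
        case (4 l)
        then show ?thesis using graph_dist_le_walk[of ?E w "[Cyc i, Leaf i l]"] wE i
            S_graph_edges(4)[OF i, of l] weight_eq[OF w i] by (simp add: f_def s_def)
      qed
    qed
    have "(\<Sum>l<d - 2. f (Leaf i l) - f (s (Leaf i l))) = (\<Sum>l\<in>{..<d - 2} - {k}. b)"
      using k by (intro sum.mono_neutral_cong_right) (auto simp: f_def s_def)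
    also have "\<dots> = (real d - 3) * b" using k by (simp add: of_nat_diff)
    finally have "(\<Sum>z\<in>B. f z - f (s z)) = 2 * a + (real d - 3) * b"
      using i unfolding B_def
      by (simp add: finite_neighbours_Cyc Cyc_notin_neighbours sum_neighbours_Cyc) (simp add: f_def s_def)
    then show "kappa_leaf d (a / b)
        = (real d + 1 - (\<Sum>z\<in>B. f z - f (s z)) / w {Leaf i k, Cyc i}) / real d"
      using pos weight_eq(6)[OF w i k] by (simp add: kappa_leaf_def field_simps)
  qed
qed

text \<open>There are two ways round: three edges through edge \<open>j\<close>, or the
  \<open>g - 3\<close> remaining cycle edges. For \<open>g = 3\<close> the two vertices
  coincide.\<close>

lemma dist_outer_neighbours:
  assumes w: "leaf_cycle_weighting g d b a w" and pos: "0 < a" "0 < b" and j: "j < g"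
  shows "graph_dist (S_graph g d) w (Cyc (prv g j)) (Cyc (nxt g (nxt g j))) \<le> a * real (min 3 (g - 3))"
proof -
  let ?E = "S_graph g d"
  have wE: "0 \<le> w e" if "e \<in> ?E" for e using weight_pos[OF w pos that] by simp
  consider "g = 3" | "g = 4" | "g = 5" | "6 \<le> g" using g by linarith
  then show ?thesis
  proof cases
    case 1
    then have "prv g j = nxt g (nxt g j)" using j by (auto simp: nxt_if prv_if)
    then show ?thesis using graph_dist_le_walk[of ?E w "[Cyc (prv g j)]"] wE 1 by simp
  next
    case 2
    then have "prv g j = nxt g (nxt g (nxt g j))" "min 3 (g - 3) = 1" using j by (auto simp: nxt_if prv_if)
    then show ?thesis using graph_dist_le_walk[of ?E w "[Cyc (prv g j), Cyc (nxt g (nxt g j))]"] wE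
        S_graph_edges(2)[of "nxt g (nxt g j)"] weight_eq(4)[OF w, of "nxt g (nxt g j)"] by simp
  next
    case 3
    then have "prv g j = nxt g (nxt g (nxt g (nxt g j)))" "min 3 (g - 3) = 2"
      using j by (auto simp: nxt_if prv_if)
    then show ?thesis
      using graph_dist_le_walk[of ?E w "[Cyc (prv g j), Cyc (nxt g (nxt g (nxt g j))), Cyc (nxt g (nxt g j))]"] wE
        S_graph_edges(2)[of "nxt g (nxt g j)"] weight_eq(4)[OF w, of "nxt g (nxt g j)"]
        S_graph_edges(2)[of "nxt g (nxt g (nxt g j))"] weight_eq(4)[OF w, of "nxt g (nxt g (nxt g j))"]
      by simp
  next
    case 4
    then have "min 3 (g - 3) = 3" by simp
    then show ?thesis
      using graph_dist_le_walk[of ?E w "[Cyc (prv g j), Cyc j, Cyc (nxt g j), Cyc (nxt g (nxt g j))]"] wE j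
        S_graph_edges(3)[of j] weight_eq(5)[OF w, of j]
        S_graph_edges(1)[of j] weight_eq(1)[OF w, of j]
        S_graph_edges(1)[of "nxt g j"] weight_eq(1)[OF w, of "nxt g j"]
      by simp
  qed
qed

text \<open>The units at both endpoints stay, since each endpoint is also a neighbour of the other.
  Each of the \<open>d - 2\<close> leaves moves to its counterpart at cost \<open>a + 2 * b\<close>,
  and the outer neighbours are matched at cost \<open>a * min 3 (g - 3)\<close>.\<close>

lemma has_LLY_curvature_cycle:
  assumes w: "leaf_cycle_weighting g d b a w" and pos: "0 < a" "0 < b" and j: "j < g"
  shows "has_LLY_curvature (S_graph g d) w (Cyc j) (Cyc (nxt g j)) (kappa_cyc g d (a / b))"
proof -
  let ?E = "S_graph g d" and ?j' = "nxt g j"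
  define B where "B = insert (Cyc j) (neighbours ?E (Cyc j))"
  define t where "t z = (case z of Cyc i \<Rightarrow> if i = prv g j then Cyc (nxt g ?j') else Cyc i
      | Leaf i k \<Rightarrow> Leaf ?j' k)" for z
  \<comment> \<open>In units of \<open>a\<close>, \<open>h i\<close> is the potential \<open>i\<close> steps after \<open>Cyc j\<close>. The outer neighbours are \<open>2\<close> and
    \<open>g - 1\<close> steps after it, and \<open>c\<close> is chosen so that their potentials differ by their distance.\<close>
  define c :: real where "c = (if g = 3 then 2 else if g < 6 then 3 else 4)"
  define h :: "nat \<Rightarrow> real" where "h i = min (real i) (max (-1) (c - real i))" for i
  define off where "off i = (i + g - j) mod g" for i
  \<comment> \<open>Lowering the leaves at \<open>Cyc j\<close> and raising those at its successor
    by \<open>b\<close> makes leaf-to-leaf transport tight.\<close>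
  define f where "f z = (case z of Cyc i \<Rightarrow> a * h (off i)
      | Leaf i k \<Rightarrow> a * h (off i) + (if i = j then - b else if i = ?j' then b else 0))" for z
  have off_if: "off i = (if j \<le> i then i - j else i + g - j)" if "i < g" for i
    using that j by (auto simp: off_def mod_if)
  have off: "off j = 0" "off ?j' = 1" "off (nxt g ?j') = 2" "off (prv g j) = g - 1"
    using j g by (auto simp: off_if nxt_if prv_if)
  have h: "h 0 = 0" "h 1 = 1" "h 2 - h (g - 1) = real (min 3 (g - 3))"
  proof -
    show "h 0 = 0" "h 1 = 1" by (auto simp: h_def c_def)
    consider "g = 3" | "g = 4" | "g = 5" | "6 \<le> g" using g by linarith
    then show "h 2 - h (g - 1) = real (min 3 (g - 3))" by cases (auto simp: h_def c_def of_nat_diff)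
  qed
  have f: "f (Cyc j) = 0" "f (Cyc ?j') = a" "\<And>k. f (Leaf j k) = - b" "\<And>k. f (Leaf ?j' k) = a + b"
    "f (Cyc (nxt g ?j')) - f (Cyc (prv g j)) = a * real (min 3 (g - 3))"
    using j by (simp_all add: f_def off h del: One_nat_def flip: right_diff_distrib)
  have wE: "0 \<le> w e" if "e \<in> ?E" for e using weight_pos[OF w pos that] by simp
  show ?thesis
  proof (rule has_LLY_curvature_certificate[where f = f and B = B and s = "\<lambda>z. z" and t = t and n = d])
    show "0 < w e" if "e \<in> ?E" for e using weight_pos[OF w pos that] .
    show "f v - f u \<le> w {u, v}" if "{u, v} \<in> ?E" for u v
    proof (rule lipschitz_on_edges[OF w _ _ that])
      fix i assume i: "i < g"
      have o: "off (nxt g i) = (if Suc (off i) = g then 0 else Suc (off i))" "off i < g"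
        using i j by (auto simp: off_if nxt_if)
      have "\<bar>h (off (nxt g i)) - h (off i)\<bar> \<le> 1"
      proof (cases "Suc (off i) = g")
        \<comment> \<open>The edge closing the cycle joins offset \<open>g - 1\<close> to offset 0;
          there \<open>h\<close> is 0 or -1 on one side and 0 on the other.\<close>
        case True
        then have "off i = g - 1" by simp
        then show ?thesis using o True g by (auto simp: h_def c_def of_nat_diff)
      next
        case False
        then show ?thesis using o by (auto simp: h_def)
      qed
      then show "\<bar>f (Cyc (nxt g i)) - f (Cyc i)\<bar> \<le> a"
        using pos by (simp add: f_def abs_mult flip: right_diff_distrib)
    qed (use pos in \<open>auto simp: f_def\<close>)
    show "{Cyc j, Cyc ?j'} \<in> ?E" using j by (rule S_graph_edges)
    show "w {Cyc j, Cyc ?j'} = f (Cyc ?j') - f (Cyc j)"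
      using weight_eq(1)[OF w j] by (simp add: f)
    show "paths ?E u v \<noteq> {}"
      if "u \<in> insert (Cyc j) (neighbours ?E (Cyc j))" "v \<in> insert (Cyc ?j') (neighbours ?E (Cyc ?j'))" for u v
      using that neighbours_subset_S_vertices j
      by (intro paths_S_graph_nonempty) (auto simp: S_vertices_def)
    show "spreads ?E d B (\<lambda>z. z) (Cyc j)"
      using spreads_bij_betw[of "\<lambda>z. z" B "Cyc j" ?E] j d
      by (simp add: degree_Cyc Cyc_notin_neighbours B_def bij_betw_def)
    \<comment> \<open>So \<open>t\<close> is a bijection between the two closed neighbourhoods. For
      \<open>g = 3\<close> the outer neighbours agree and \<open>t\<close> fixes all cycle
      vertices.\<close>
    have "inj_on t B" using j by (auto simp: inj_on_def B_def neighbours_Cyc t_def)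
    moreover have "t ` B = insert (Cyc ?j') (neighbours ?E (Cyc ?j'))"
      using j by (auto simp: B_def neighbours_Cyc t_def image_image)
    ultimately show "spreads ?E d B t (Cyc ?j')"
      using spreads_bij_betw[of t B "Cyc ?j'" ?E] j d
      by (simp add: degree_Cyc Cyc_notin_neighbours bij_betw_def)
    show "graph_dist ?E w z (t z) \<le> f (t z) - f z" if "z \<in> B" for z
    proof -
      have "t z = z \<or> z = Cyc (prv g j) \<or> (\<exists>k<d - 2. z = Leaf j k)"
        using that j by (auto simp: B_def neighbours_Cyc t_def)
      then consider "t z = z" | "z = Cyc (prv g j)" | k where "k < d - 2" "z = Leaf j k" by blast
      then show ?thesis
      proof cases
        case 1
        then show ?thesis using graph_dist_le_walk[of ?E w "[z]"] wE by simp
      next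
        case 2
        then show ?thesis using dist_outer_neighbours[OF w pos j] by (simp add: t_def f)
      next
        case (3 k)
        then show ?thesis
          using graph_dist_le_walk[of ?E w "[Leaf j k, Cyc j, Cyc ?j', Leaf ?j' k]"] wE j
            S_graph_edges(5)[OF j 3(1)] S_graph_edges(1)[OF j] S_graph_edges(4)[of ?j' k]
            weight_eq[OF w j] weight_eq(3)[OF w, of ?j' k] by (simp add: f t_def)
      qed
    qed
    have "f (t (Cyc (prv g j))) - f (Cyc (prv g j)) = a * real (min 3 (g - 3))"
      "f (t (Cyc ?j')) - f (Cyc ?j') = 0" "f (t (Cyc j)) - f (Cyc j) = 0"
      "\<And>k. f (t (Leaf j k)) - f (Leaf j k) = a + 2 * b"
      using j f by (simp_all add: t_def)
    then have "(\<Sum>z\<in>B. f (t z) - f z) = a * real (min 3 (g - 3)) + (real d - 2) * (a + 2 * b)"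
      using j d unfolding B_def
      by (simp add: finite_neighbours_Cyc Cyc_notin_neighbours sum_neighbours_Cyc of_nat_diff)
    moreover have "max (6 - real g) 0 = 3 - real (min 3 (g - 3))"
      using g by (auto simp: min_def max_def of_nat_diff)
    ultimately show "kappa_cyc g d (a / b)
        = (real d + 1 - (\<Sum>z\<in>B. f (t z) - f z) / w {Cyc j, Cyc ?j'}) / real d"
      unfolding kappa_cyc_def weight_eq(1)[OF w j]
      using pos d by (simp only:) (simp add: field_simps)
  qed
qed

section \<open>The Einstein condition and balance for symmetric weightings\<close>

lemma has_LLY_curvature_leaf_edges:
  assumes w: "leaf_cycle_weighting g d b a w" and pos: "0 < a" "0 < b" and "{x, y} \<in> leaf_edges g d"
  shows "has_LLY_curvature (S_graph g d) w x y (kappa_leaf d (a / b))"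
proof -
  obtain i k where ik: "i < g" "k < d - 2" "{x, y} = {Cyc i, Leaf i k}"
    using assms(4) by (auto simp: leaf_edges_def)
  then show ?thesis
    using has_LLY_curvature_leaf[OF w pos ik(1,2)] by (auto simp: doubleton_eq_iff has_LLY_curvature_commute)
qed

lemma has_LLY_curvature_cycle_edges:
  assumes w: "leaf_cycle_weighting g d b a w" and pos: "0 < a" "0 < b" and "{x, y} \<in> cycle_edges g"
  shows "has_LLY_curvature (S_graph g d) w x y (kappa_cyc g d (a / b))"
proof -
  obtain i where i: "i < g" "{x, y} = {Cyc i, Cyc (nxt g i)}"
    using assms(4) by (auto simp: cycle_edges_def cycle_edge_def nxt_def)
  then show ?thesis
    using has_LLY_curvature_cycle[OF w pos i(1)] by (auto simp: doubleton_eq_iff has_LLY_curvature_commute)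
qed

text \<open>Limits are unique, so a common curvature equals both formulas; one leaf edge and one
  cycle edge give the equation. Conversely, these formulas cover all edges.\<close>

lemma symmetric_einstein_metric_iff:
  "symmetric_einstein_metric g d w \<longleftrightarrow>
     (\<exists>b>0. \<exists>a>0. leaf_cycle_weighting g d b a w \<and> Delta g d (a / b) = 0)"
proof -
  have "(\<exists>\<kappa>. einstein_metric (S_graph g d) w \<kappa>) \<longleftrightarrow> Delta g d (a / b) = 0"
    if w: "leaf_cycle_weighting g d b a w" and pos: "0 < a" "0 < b" for a b
  proof
    assume "\<exists>\<kappa>. einstein_metric (S_graph g d) w \<kappa>"
    then obtain \<kappa> where \<kappa>: "\<And>x y. {x, y} \<in> S_graph g d \<Longrightarrow> has_LLY_curvature (S_graph g d) w x y \<kappa>"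
      by (auto simp: einstein_metric_def)
    have uniq: "\<kappa>' = \<kappa>" if "has_LLY_curvature (S_graph g d) w x y \<kappa>'" "{x, y} \<in> S_graph g d" for x y \<kappa>'
      using \<kappa>[OF that(2)] that(1) unfolding has_LLY_curvature_def
      by (meson tendsto_unique trivial_limit_at_left_real)
    have "0 < g" "0 < d - 2" using g d by auto
    then show "Delta g d (a / b) = 0"
      using uniq[OF has_LLY_curvature_leaf[OF w pos, of 0 0]] uniq[OF has_LLY_curvature_cycle[OF w pos, of 0]]
      by (simp add: S_graph_edges Delta_def)
  next
    assume "Delta g d (a / b) = 0"
    then have "kappa_cyc g d (a / b) = kappa_leaf d (a / b)" by (simp add: Delta_def)
    then have "einstein_metric (S_graph g d) w (kappa_leaf d (a / b))"
      unfolding einstein_metric_def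
      using weight_pos[OF w pos] has_LLY_curvature_leaf_edges[OF w pos] has_LLY_curvature_cycle_edges[OF w pos]
      by (auto simp: S_graph_def)
    then show "\<exists>\<kappa>. einstein_metric (S_graph g d) w \<kappa>" ..
  qed
  then show ?thesis unfolding symmetric_einstein_metric_def by blast
qed

text \<open>With all cycle weights equal to \<open>a\<close>, each condition reads
  \<open>3 * a \<le> g * a / 2\<close>.\<close>

lemma balanced_iff:
  assumes w: "leaf_cycle_weighting g d b a w" and "0 < a"
  shows "balanced g (cycle_edge g) w \<longleftrightarrow> 6 \<le> g"
proof -
  have c: "w (cycle_edge g j) = a" if "j < g" for j
    using weight_eq(1)[OF w that] by (simp add: cycle_edge_def nxt_def)
  have "balanced g (cycle_edge g) w \<longleftrightarrow> (\<forall>j<g. a + a + a \<le> real g * a / 2)"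
    using g by (auto simp: balanced_def c)
  also have "\<dots> \<longleftrightarrow> a + a + a \<le> real g * a / 2"
    using g by (metis gr0I not_numeral_le_zero)
  also have "\<dots> \<longleftrightarrow> 6 * a \<le> real g * a" by auto
  also have "\<dots> \<longleftrightarrow> 6 \<le> g" using \<open>0 < a\<close> by simp
  finally show ?thesis .
qed

lemma finite_S_graph: "finite (S_graph g d)"
proof -
  have "cycle_edges g = cycle_edge g ` {..<g}" by (auto simp: cycle_edges_def)
  moreover have "leaf_edges g d = (\<lambda>(i, k). {Cyc i, Leaf i k}) ` ({..<g} \<times> {..<d - 2})"
    by (auto simp: leaf_edges_def)
  ultimately show ?thesis by (simp add: S_graph_def)
qed

lemma S_graph_edge_cases:
  assumes "e \<in> S_graph g d"
  obtains (cycle) i where "i < g" "e = {Cyc i, Cyc (nxt g i)}"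
    | (leaf) i k where "i < g" "k < d - 2" "e = {Cyc i, Leaf i k}"
  using assms by (auto simp: S_graph_def cycle_edges_def cycle_edge_def leaf_edges_def nxt_def)

text \<open>Connectedness of the line graph, which yields irreducibility of the Ricci matrix: from
  any edge one reaches a cycle edge, then goes round the cycle, then out to each leaf.\<close>

lemma intersecting_edges_connected:
  assumes M: "M \<subseteq> S_graph g d" "M \<noteq> {}"
    and closed: "\<And>e f. e \<in> M \<Longrightarrow> f \<in> S_graph g d \<Longrightarrow> e \<inter> f \<noteq> {} \<Longrightarrow> f \<in> M"
  shows "M = S_graph g d"
proof -
  define c where "c i = {Cyc i, Cyc (nxt g i)}" for i
  have cE: "c i \<in> S_graph g d" if "i < g" for i using that by (simp add: c_def S_graph_edges)
  obtain e where "e \<in> M" using M by blast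
  obtain i where "i < g" "Cyc i \<in> e" using \<open>e \<in> M\<close> M S_graph_edge_cases by (metis insertCI subsetD)
  then have ci: "c i \<in> M" by (intro closed[OF \<open>e \<in> M\<close> cE]) (auto simp: c_def)
  have step: "c ((i + n) mod g) \<in> M" for n
  proof (induction n)
    case 0
    then show ?case using ci \<open>i < g\<close> by simp
  next
    case (Suc n)
    have "(i + Suc n) mod g = nxt g ((i + n) mod g)" by (simp add: nxt_def mod_Suc_eq)
    then show ?case using Suc by (intro closed[OF Suc cE]) (auto simp: c_def)
  qed
  have cM: "c j \<in> M" if "j < g" for j
    \<comment> \<open>Adding \<open>g\<close> keeps the number of steps from \<open>i\<close> to
      \<open>j\<close> free of truncated subtraction.\<close>
    using step[of "j + g - i"] that \<open>i < g\<close> by simp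
  have "f \<in> M" if "f \<in> S_graph g d" for f
    using that
  proof (cases rule: S_graph_edge_cases)
    case (leaf j k)
    then show ?thesis by (intro closed[OF cM that]) (auto simp: c_def)
  qed (use cM in \<open>auto simp: c_def\<close>)
  then show ?thesis using M by blast
qed

end

section \<open>Perron eigenvectors and the Ricci matrix\<close>

text \<open>Comparing a vector with the positive eigenvector entrywise, at the index of extremal ratio, bounds
  its eigenvalue and, by irreducibility, gives proportionality.\<close>

lemma perron_eigenvector_onI:
  assumes I: "finite I" "I \<noteq> {}"
    and A: "\<And>i j. i \<in> I \<Longrightarrow> j \<in> I \<Longrightarrow> i \<noteq> j \<Longrightarrow> 0 \<le> A i j"
    and w: "\<And>i. i \<in> I \<Longrightarrow> 0 < w i"
    and Aw: "\<And>i. i \<in> I \<Longrightarrow> (\<Sum>j\<in>I. A i j * w j) = \<theta> * w i"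
    and irr: "\<And>M. M \<subseteq> I \<Longrightarrow> M \<noteq> {} \<Longrightarrow>
      (\<And>i j. i \<in> M \<Longrightarrow> j \<in> I \<Longrightarrow> i \<noteq> j \<Longrightarrow> 0 < A i j \<Longrightarrow> j \<in> M) \<Longrightarrow> M = I"
  shows "perron_eigenvector_on I A w"
proof -
  have max: "\<exists>i\<in>I. \<forall>j\<in>I. r j \<le> r i" for r :: "'a \<Rightarrow> real"
  proof -
    have "Max (r ` I) \<in> r ` I" using I by simp
    then obtain i where "i \<in> I" "Max (r ` I) = r i" by blast
    then show ?thesis using I by (metis Max_ge finite_imageI imageI)
  qed
  have eig: "eigenvector_on I A w \<theta>"
    using I(2) w Aw by (force simp: eigenvector_on_def)
  have bound: "\<mu> \<le> \<theta>" if v: "eigenvector_on I A v \<mu>" for v \<mu>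
  proof -
    obtain i where i: "i \<in> I" "\<And>j. j \<in> I \<Longrightarrow> \<bar>v j\<bar> / w j \<le> \<bar>v i\<bar> / w i"
      using max[of "\<lambda>j. \<bar>v j\<bar> / w j"] by blast
    obtain l where l: "l \<in> I" "v l \<noteq> 0" using v by (auto simp: eigenvector_on_def)
    \<comment> \<open>With \<open>c\<close> the largest ratio and the sign normalised at
      \<open>i\<close>, the vector \<open>u\<close> lies below \<open>c * w\<close> and touches it
      at \<open>i\<close>.\<close>
    define c where "c = \<bar>v i\<bar> / w i"
    define u where "u j = sgn (v i) * v j" for j
    have "0 < \<bar>v l\<bar> / w l" using l w by simp
    then have "0 < c" using i(2)[OF l(1)] unfolding c_def by linarith
    then have "v i \<noteq> 0" by (auto simp: c_def)
    have ui: "u i = c * w i" "0 < u i" using w[OF i(1)] \<open>v i \<noteq> 0\<close>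
      by (auto simp: u_def c_def sgn_if)
    have le: "u j \<le> c * w j" if "j \<in> I" for j
    proof -
      have "u j \<le> \<bar>v j\<bar>" by (auto simp: u_def sgn_if)
      also have "\<dots> \<le> c * w j" using i(2)[OF that] w[OF that] by (simp add: c_def pos_divide_le_eq)
      finally show ?thesis .
    qed
    have "\<mu> * u i = sgn (v i) * (\<mu> * v i)" by (simp add: u_def)
    also have "\<mu> * v i = (\<Sum>j\<in>I. A i j * v j)" using v i(1) by (simp add: eigenvector_on_def)
    also have "sgn (v i) * \<dots> = (\<Sum>j\<in>I. A i j * u j)"
      by (simp add: u_def sum_distrib_left mult.left_commute)
    also have "\<dots> \<le> (\<Sum>j\<in>I. A i j * (c * w j))"
    proof (rule sum_mono)
      fix j assume "j \<in> I"
      then show "A i j * u j \<le> A i j * (c * w j)"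
        \<comment> \<open>The diagonal entry may be negative, but at \<open>j = i\<close> both sides
          are equal.\<close>
        using ui le A[OF i(1)] by (cases "j = i") (auto intro: mult_left_mono)
    qed
    also have "\<dots> = c * (\<Sum>j\<in>I. A i j * w j)" by (simp add: sum_distrib_left mult.left_commute)
    also have "\<dots> = \<theta> * u i" using Aw[OF i(1)] ui by simp
    finally show ?thesis using ui(2) by simp
  qed
  have unique: "\<exists>c>0. \<forall>i\<in>I. u i = c * w i"
    if u: "eigenvector_on I A u \<theta>" and upos: "\<forall>i\<in>I. 0 < u i" for u
  proof -
    obtain i where i: "i \<in> I" "\<And>j. j \<in> I \<Longrightarrow> u i / w i \<le> u j / w j"
      using max[of "\<lambda>j. - (u j / w j)"] by auto
    define c where "c = u i / w i"
    \<comment> \<open>Now \<open>c\<close> is the smallest ratio, so \<open>z\<close> is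
      nonnegative, vanishes at \<open>i\<close> and satisfies the same linear equation. Zeros of
      \<open>z\<close> spread along positive entries of \<open>A\<close>.\<close>
    define z where "z j = u j - c * w j" for j
    have z0: "0 \<le> z j" if "j \<in> I" for j
      using i(2)[OF that] w[OF that] by (simp add: z_def c_def pos_le_divide_eq)
    have Az: "(\<Sum>k\<in>I. A j k * z k) = \<theta> * z j" if "j \<in> I" for j
    proof -
      have "(\<Sum>k\<in>I. A j k * z k) = (\<Sum>k\<in>I. A j k * u k) - c * (\<Sum>k\<in>I. A j k * w k)"
        by (simp add: z_def right_diff_distrib sum_subtractf sum_distrib_left mult.left_commute)
      then show ?thesis using u that Aw[OF that] by (simp add: eigenvector_on_def z_def right_diff_distrib)
    qed
    have "{j \<in> I. z j = 0} = I"
    proof (rule irr)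
      show "{j \<in> I. z j = 0} \<noteq> {}" using i(1) w[OF i(1)] by (auto simp: z_def c_def)
      fix j k assume jk: "j \<in> {j \<in> I. z j = 0}" "k \<in> I" "j \<noteq> k" "0 < A j k"
      then have nn: "0 \<le> A j l * z l" if "l \<in> I" for l
        using that A z0 by (cases "l = j") auto
      have "(\<Sum>l\<in>I. A j l * z l) = 0" using jk Az by simp
      then have "\<forall>l\<in>I. A j l * z l = 0" using nn by (subst (asm) sum_nonneg_eq_0_iff[OF I(1)]) auto
      then have "A j k * z k = 0" using jk(2) by blast
      then show "k \<in> {j \<in> I. z j = 0}" using jk by simp
    qed auto
    moreover have "0 < c" using i(1) upos w by (simp add: c_def)
    ultimately show ?thesis by (intro exI[of _ c]) (auto simp: z_def)
  qed
  show ?thesis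
    unfolding perron_eigenvector_on_def largest_eigenvalue_on_def
    by (rule exI[of _ \<theta>]) (use eig bound unique w in auto)
qed

text \<open>At each endpoint of \<open>e\<close> the sum over all incident edges also counts
  \<open>e\<close>, with coefficient \<open>1 / degree\<close>. The diagonal has the opposite sign,
  hence the correction by \<open>2 * w e\<close>.\<close>

lemma ricci_matrix_row:
  fixes w :: "'v set \<Rightarrow> real"
  assumes E: "finite E" and edge: "\<And>f. f \<in> E \<Longrightarrow> \<exists>u v. f = {u, v}" and e: "e \<in> E"
  shows "(\<Sum>f\<in>E. ricci_matrix E e f * w f)
    = (\<Sum>z\<in>e. ((\<Sum>u\<in>neighbours E z. w {z, u}) - 2 * w e) / real (degree E z))"
proof -
  have fe: "finite e" using edge[OF e] by auto
  define r where "r z = 1 / real (degree E z)" for z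
  define N where "N z = (\<Sum>u\<in>neighbours E z. w {z, u})" for z
  have R: "ricci_matrix E e f = (\<Sum>z\<in>e. if z \<in> f then r z else 0) - (if f = e then 2 * (\<Sum>z\<in>e. r z) else 0)" for f
  proof (cases "f = e")
    case True
    have "(\<Sum>z\<in>e. if z \<in> e then r z else 0) = (\<Sum>z\<in>e. r z)" by (rule sum.cong) auto
    then show ?thesis using True by (simp add: ricci_matrix_def r_def)
  next
    case False
    then show ?thesis using fe by (simp add: ricci_matrix_def sum.inter_restrict flip: r_def)
  qed
  have S: "(\<Sum>f\<in>E. if z \<in> f then w f else 0) = (\<Sum>u\<in>neighbours E z. w {z, u})" for z
  proof -
    have "{f \<in> E. z \<in> f} = (\<lambda>u. {z, u}) ` neighbours E z"
      using edge by (fastforce simp: neighbours_def insert_commute)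
    moreover have "inj_on (\<lambda>u. {z, u}) (neighbours E z)" by (auto simp: inj_on_def doubleton_eq_iff)
    ultimately show ?thesis using E by (simp add: sum.reindex flip: sum.inter_filter)
  qed
  have "(\<Sum>f\<in>E. ricci_matrix E e f * w f)
      = (\<Sum>f\<in>E. \<Sum>z\<in>e. r z * (if z \<in> f then w f else 0)) - (\<Sum>f\<in>E. if f = e then 2 * (\<Sum>z\<in>e. r z) * w f else 0)"
    unfolding R left_diff_distrib sum_subtractf sum_distrib_right
    by (intro arg_cong2[of _ _ _ _ "(-)"] sum.cong refl) auto
  also have "(\<Sum>f\<in>E. \<Sum>z\<in>e. r z * (if z \<in> f then w f else 0)) = (\<Sum>z\<in>e. r z * (\<Sum>u\<in>neighbours E z. w {z, u}))"
    by (subst sum.swap) (simp only: S flip: sum_distrib_left)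
  also have "(\<Sum>f\<in>E. if f = e then 2 * (\<Sum>z\<in>e. r z) * w f else 0) = 2 * (\<Sum>z\<in>e. r z) * w e"
    using E e by simp
  finally have "(\<Sum>f\<in>E. ricci_matrix E e f * w f) = (\<Sum>z\<in>e. r z * N z) - (\<Sum>z\<in>e. 2 * r z * w e)"
    by (simp add: N_def sum_distrib_left sum_distrib_right)
  also have "\<dots> = (\<Sum>z\<in>e. (N z - 2 * w e) / real (degree E z))"
    unfolding sum_subtractf[symmetric] by (simp add: r_def diff_divide_distrib)
  finally show ?thesis by (simp add: N_def)
qed

section \<open>Einstein metrics\<close>

text \<open>In this form both terms depending on \<open>a\<close> are visibly increasing, and the
  remaining one is constant.\<close>

lemma Delta_eq:
  "Delta g d a = (2 * a - 2 * (real d - 2) / a + (max (6 - real g) 0 - 4)) / real d"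
  by (simp add: Delta_def kappa_cyc_def kappa_leaf_def diff_divide_distrib add_divide_distrib)

lemma strict_mono_on_Delta:
  assumes "3 \<le> d"
  shows "strict_mono_on {0<..} (Delta g d)"
proof (rule strict_mono_onI)
  fix a b :: real assume ab: "a \<in> {0<..}" "b \<in> {0<..}" "a < b"
  then have "2 * (real d - 2) / b < 2 * (real d - 2) / a"
    using assms by (intro divide_strict_left_mono) auto
  then show "Delta g d a < Delta g d b"
    unfolding Delta_eq using ab assms by (intro divide_strict_right_mono) auto
qed

lemma Delta_at_bot:
  assumes "3 \<le> d"
  shows "filterlim (Delta g d) at_bot (at_right 0)"
  unfolding filterlim_at_bot
proof
  fix Z :: real
  define m where "m = max (6 - real g) 0"
  define K where "K = max 1 (m - Z * real d)"
  have K: "1 \<le> K" "m - Z * real d \<le> K" by (auto simp: K_def)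
  \<comment> \<open>Below \<open>r\<close> the term \<open>2 * a\<close> is at most 2, while the
    subtracted fraction is at least \<open>K\<close>.\<close>
  define r where "r = min 1 (2 * (real d - 2) / K)"
  show "eventually (\<lambda>a. Delta g d a \<le> Z) (at_right 0)"
  proof (rule eventually_at_rightI)
    show "0 < r" using assms K by (simp add: r_def)
    fix a assume a: "a \<in> {0<..<r}"
    then have "K \<le> 2 * (real d - 2) / a" using K by (simp add: r_def field_simps)
    moreover have "a \<le> 1" using a by (simp add: r_def)
    ultimately have "2 * a - 2 * (real d - 2) / a + (m - 4) \<le> Z * real d" using K by linarith
    then show "Delta g d a \<le> Z" using assms by (simp add: Delta_eq m_def pos_divide_le_eq)
  qed
qed

lemma Delta_at_top:
  assumes "3 \<le> d"
  shows "filterlim (Delta g d) at_top at_top"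
  unfolding filterlim_at_top
proof
  fix Z :: real
  show "eventually (\<lambda>a. Z \<le> Delta g d a) at_top"
  proof (rule eventually_at_top_linorderI)
    define P where "P = \<bar>Z\<bar> * real d"
    define m where "m = max (6 - real g) 0"
    fix a assume "max 1 (\<bar>Z\<bar> * real d + real d + 2) \<le> a"
    then have a: "1 \<le> a" "P + real d + 2 \<le> a" unfolding P_def max.bounded_iff by blast+
    have "2 * (real d - 2) / a \<le> 2 * (real d - 2)"
      using a assms divide_left_mono[of 1 a "2 * (real d - 2)"] by simp
    moreover have "Z * real d \<le> P" "0 \<le> P" by (auto simp: P_def intro: mult_right_mono)
    moreover have "0 \<le> m" by (simp add: m_def)
    moreover have "2 * P + 2 * real d + 4 \<le> 2 * a" using a(2) by simp
    ultimately have "Z * real d \<le> 2 * a - 2 * (real d - 2) / a + (m - 4)" by argo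
    then show "Z \<le> Delta g d a" using assms by (simp add: Delta_eq m_def pos_le_divide_eq)
  qed
qed

text \<open>Clearing the denominator turns the equation into \<open>a * a + p * a = d - 2\<close>,
  whose positive root is written down. Strict monotonicity gives uniqueness.\<close>

lemma Delta_unique_zero:
  assumes "3 \<le> d"
  shows "\<exists>!a. a > 0 \<and> Delta g d a = 0"
proof (rule ex_ex1I)
  define p where "p = (max (6 - real g) 0 - 4) / 2"
  define a where "a = (sqrt (p\<^sup>2 + 4 * (real d - 2)) - p) / 2"
  have "\<bar>p\<bar> < sqrt (p\<^sup>2 + 4 * (real d - 2))" using assms by (intro real_less_rsqrt) auto
  then have "0 < a" by (simp add: a_def)
  have "2 * a + p = sqrt (p\<^sup>2 + 4 * (real d - 2))" by (simp add: a_def field_simps)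
  then have "(2 * a + p)\<^sup>2 = p\<^sup>2 + 4 * (real d - 2)" using assms by simp
  then have "a * a + p * a = real d - 2" by (simp add: power2_eq_square algebra_simps)
  then have "2 * a - 2 * (real d - 2) / a + 2 * p = 0" using \<open>0 < a\<close> by (simp add: field_simps)
  moreover have "2 * p = max (6 - real g) 0 - 4" by (simp add: p_def)
  ultimately have "Delta g d a = 0" unfolding Delta_eq by simp
  with \<open>0 < a\<close> show "\<exists>a. a > 0 \<and> Delta g d a = 0" by blast
  show "a = b" if "a > 0 \<and> Delta g d a = 0" "b > 0 \<and> Delta g d b = 0" for a b
    using that strict_mono_on_Delta[OF assms, of g]
    by (metis greaterThan_iff inj_onD strict_mono_on_imp_inj_on)
qed

text \<open>On a symmetric vector the row of a cycle edge evaluates to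
  \<open>2 * (d - 2) * b / d\<close> and that of a leaf edge to \<open>(2 * a - 4 * b) / d\<close>.
  For \<open>g \<ge> 6\<close> the maximum in \<open>kappa_cyc\<close> vanishes, and these are
  \<open>\<theta> * a\<close> and \<open>\<theta> * b\<close>.\<close>

lemma perron_eigenvector_on_S_graph:
  assumes g: "6 \<le> g" and d: "3 \<le> d"
    and w: "leaf_cycle_weighting g d b a w" and pos: "0 < a" "0 < b" and zero: "Delta g d (a / b) = 0"
  shows "perron_eigenvector_on (S_graph g d) (ricci_matrix (S_graph g d)) w"
proof -
  let ?E = "S_graph g d"
  have g3: "3 \<le> g" using g by simp
  note [simp] = nxt_prv_less[OF g3] and gd = g3 d
  \<comment> \<open>This is \<open>- kappa_leaf d (a / b)\<close>. The leaf equation holds by this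
    choice; the cycle equation is where the zero of \<open>Delta\<close> is used.\<close>
  define \<theta> where "\<theta> = (2 * a / b - 4) / d"
  have "2 * (a / b) - 2 * (real d - 2) / (a / b) - 4 = 0" using zero d g by (simp add: Delta_eq)
  then have "a * a - 2 * a * b = (real d - 2) * b * b" using pos by (simp add: field_simps)
  moreover have "\<theta> * a = 2 * (a * a - 2 * a * b) / (b * d)" using pos d by (simp add: \<theta>_def field_simps)
  ultimately have "\<theta> * a = 2 * ((real d - 2) * b * b) / (b * d)" by simp
  then have \<theta>a: "\<theta> * a = 2 * (real d - 2) * b / d" using pos by simp
  have \<theta>b: "\<theta> * b = (2 * a - 4 * b) / d" using pos by (simp add: \<theta>_def field_split_simps)
  have deg: "0 < degree ?E z" if "z \<in> e" "e \<in> ?E" for z e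
    using that(2,1) d
    by (cases rule: S_graph_edge_cases[OF gd, consumes 1]) (auto simp: degree_Cyc[OF gd] degree_Leaf[OF gd])
  have sumC: "(\<Sum>u\<in>neighbours ?E (Cyc i). w {Cyc i, u}) = 2 * a + (real d - 2) * b" if "i < g" for i
    using that d by (simp add: sum_neighbours_Cyc[OF gd] weight_eq[OF gd w] of_nat_diff)
  show ?thesis
  proof (rule perron_eigenvector_onI[where \<theta> = \<theta>])
    show "finite ?E" by (rule finite_S_graph[OF gd])
    show "?E \<noteq> {}" using S_graph_edges(1)[OF gd, of 0] g by auto
    show "0 \<le> ricci_matrix ?E e f" if "e \<noteq> f" for e f
      using that by (simp add: ricci_matrix_def sum_nonneg)
    show "0 < w e" if "e \<in> ?E" for e using weight_pos[OF gd w pos that] .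
    show "(\<Sum>f\<in>?E. ricci_matrix ?E e f * w f) = \<theta> * w e" if e: "e \<in> ?E" for e
    proof -
      have row: "(\<Sum>f\<in>?E. ricci_matrix ?E e f * w f)
          = (\<Sum>z\<in>e. ((\<Sum>u\<in>neighbours ?E z. w {z, u}) - 2 * w e) / real (degree ?E z))"
        by (rule ricci_matrix_row[OF finite_S_graph[OF gd] _ e]) (blast elim: S_graph_edge_cases[OF gd])
      show ?thesis unfolding row using e
      proof (cases rule: S_graph_edge_cases[OF gd, consumes 1, case_names cycle leaf])
        case (cycle i)
        then show "(\<Sum>z\<in>e. ((\<Sum>u\<in>neighbours ?E z. w {z, u}) - 2 * w e) / real (degree ?E z)) = \<theta> * w e"
          using d \<theta>a nxt_prv[OF gd, of i]
          by (simp add: sumC degree_Cyc[OF gd] weight_eq[OF gd w] of_nat_diff)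
      next
        case (leaf i k)
        then show "(\<Sum>z\<in>e. ((\<Sum>u\<in>neighbours ?E z. w {z, u}) - 2 * w e) / real (degree ?E z)) = \<theta> * w e"
          using d \<theta>b
          by (simp add: sumC degree_Cyc[OF gd] degree_Leaf[OF gd] neighbours_Leaf[OF gd] weight_eq[OF gd w] field_simps)
      qed
    qed
    fix M assume M: "M \<subseteq> ?E" "M \<noteq> {}"
      and closed: "\<And>e f. e \<in> M \<Longrightarrow> f \<in> ?E \<Longrightarrow> e \<noteq> f \<Longrightarrow> 0 < ricci_matrix ?E e f \<Longrightarrow> f \<in> M"
    show "M = ?E"
    proof (rule intersecting_edges_connected[OF gd M])
      fix e f assume ef: "e \<in> M" "f \<in> ?E" "e \<inter> f \<noteq> {}"
      show "f \<in> M"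
      proof (cases "e = f")
        case False
        have "finite e" using ef M by (auto elim: S_graph_edge_cases[OF gd])
        then have "0 < (\<Sum>z\<in>e \<inter> f. 1 / real (degree ?E z))"
          using ef deg[of _ f] by (intro sum_pos) auto
        then show ?thesis using closed[OF ef(1,2) False] False by (simp add: ricci_matrix_def)
      qed (use ef in simp)
    qed
  qed
qed

theorem proposition7p3:
  fixes g d :: nat
  assumes "g \<ge> 3" and "d \<ge> 3"
  shows
    "(\<forall>a>0. \<forall>w. leaf_cycle_weighting g d 1 a w \<longrightarrow>
        (\<forall>x y. {x, y} \<in> leaf_edges g d \<longrightarrow>
           has_LLY_curvature (S_graph g d) w x y (kappa_leaf d a)) \<and>
        (\<forall>x y. {x, y} \<in> cycle_edges g \<longrightarrow>
           has_LLY_curvature (S_graph g d) w x y (kappa_cyc g d a)))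
     \<and> strict_mono_on {0<..} (Delta g d)
     \<and> filterlim (Delta g d) at_bot (at_right 0)
     \<and> filterlim (Delta g d) at_top at_top
     \<and> (\<exists>!a. a > 0 \<and> Delta g d a = 0)
     \<and> (\<exists>w. symmetric_einstein_metric g d w)
     \<and> (\<forall>w w'. symmetric_einstein_metric g d w \<and> symmetric_einstein_metric g d w' \<longrightarrow>
          (\<exists>c>0. \<forall>e\<in>S_graph g d. w' e = c * w e))
     \<and> (\<forall>w. symmetric_einstein_metric g d w \<longrightarrow>
          (g \<ge> 6 \<longrightarrow> balanced g (cycle_edge g) w \<and>
             perron_eigenvector_on (S_graph g d) (ricci_matrix (S_graph g d)) w) \<and>
          (g \<le> 5 \<longrightarrow> \<not> balanced g (cycle_edge g) w))"
proof (intro conjI)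
  note iff = symmetric_einstein_metric_iff[OF assms]
  note zero = Delta_unique_zero[OF assms(2), of g]
  show "\<forall>a>0. \<forall>w. leaf_cycle_weighting g d 1 a w \<longrightarrow>
        (\<forall>x y. {x, y} \<in> leaf_edges g d \<longrightarrow>
           has_LLY_curvature (S_graph g d) w x y (kappa_leaf d a)) \<and>
        (\<forall>x y. {x, y} \<in> cycle_edges g \<longrightarrow>
           has_LLY_curvature (S_graph g d) w x y (kappa_cyc g d a))"
    using has_LLY_curvature_leaf_edges[OF assms, of 1] has_LLY_curvature_cycle_edges[OF assms, of 1] by simp
  show "strict_mono_on {0<..} (Delta g d)" by (rule strict_mono_on_Delta[OF assms(2)])
  show "filterlim (Delta g d) at_bot (at_right 0)" by (rule Delta_at_bot[OF assms(2)])
  show "filterlim (Delta g d) at_top at_top" by (rule Delta_at_top[OF assms(2)])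
  show "\<exists>!a. a > 0 \<and> Delta g d a = 0" by (rule zero)
  show "\<exists>w. symmetric_einstein_metric g d w"
  proof -
    obtain a where a: "a > 0" "Delta g d a = 0" using zero by blast
    \<comment> \<open>No cycle edge contains a leaf, so cycle edges do get the value
      \<open>a\<close>.\<close>
    have "leaf_cycle_weighting g d 1 a (\<lambda>e. if e \<in> leaf_edges g d then 1 else a)"
      by (auto simp: leaf_cycle_weighting_def leaf_edges_def cycle_edges_def cycle_edge_def doubleton_eq_iff)
    then show ?thesis unfolding iff using a by (metis div_by_1 zero_less_one)
  qed
  show "\<forall>w w'. symmetric_einstein_metric g d w \<and> symmetric_einstein_metric g d w' \<longrightarrow>
          (\<exists>c>0. \<forall>e\<in>S_graph g d. w' e = c * w e)"
  proof (intro allI impI)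
    fix w w' assume "symmetric_einstein_metric g d w \<and> symmetric_einstein_metric g d w'"
    then obtain b a b' a' where *: "0 < b" "0 < a" "leaf_cycle_weighting g d b a w" "Delta g d (a / b) = 0"
      "0 < b'" "0 < a'" "leaf_cycle_weighting g d b' a' w'" "Delta g d (a' / b') = 0"
      unfolding iff by blast
    \<comment> \<open>Both ratios are the unique positive zero, so rescaling the leaf weight also
      matches the cycle weight.\<close>
    then have "a / b = a' / b'" using zero by (metis divide_pos_pos)
    then have "a' = b' / b * a" using * by (simp add: field_simps)
    with * show "\<exists>c>0. \<forall>e\<in>S_graph g d. w' e = c * w e"
      by (intro exI[of _ "b' / b"]) (auto simp: S_graph_def leaf_cycle_weighting_def)
  qed
  show "\<forall>w. symmetric_einstein_metric g d w \<longrightarrow>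
          (g \<ge> 6 \<longrightarrow> balanced g (cycle_edge g) w \<and>
             perron_eigenvector_on (S_graph g d) (ricci_matrix (S_graph g d)) w) \<and>
          (g \<le> 5 \<longrightarrow> \<not> balanced g (cycle_edge g) w)"
    using balanced_iff[OF assms] perron_eigenvector_on_S_graph[OF _ assms(2)] unfolding iff by fastforce
qed

end
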